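(* For any $0<\varepsilon_1<\varepsilon_2\le 0.49$ and integer $k$ with $\varepsilon_2-\varepsilon_1 \ge 2^{-O(k^{0.99})}$ and $(1-\varepsilon_1/\varepsilon_2)^{-1} \ge \log^{O(1)}(1/\varepsilon_2)$, any $(k,\varepsilon_1,\varepsilon_2)$-tolerant junta tester must make at least $k^{-\Omega(\log(1-\varepsilon_1/\varepsilon_2))}$ queries.
   Context: A function $f:\{0,1\}^n\to\{0,1\}$ is a $k$-junta if it depends on at most $k$ of its input variables. The distance between $f,g$ is $\Pr_{x\sim\{0,1\}^n}[f(x)\ne g(x)]$ for uniform $x$; $f$ is $\varepsilon$-close to a $k$-junta if its distance to some $k$-junta is at most $\varepsilon$ and $\varepsilon$-far from $k$-juntas if its distance to every $k$-junta is at least $\varepsilon$. A $(k,\varepsilon_1,\varepsilon_2)$-tolerant junta tester is a randomized (possibly adaptive) algorithm with query access to $f$ that accepts with probability at least $2/3$ if $f$ is $\varepsilon_1$-close to a $k$-junta and rejects with probability at least $2/3$ if $f$ is $\varepsilon_2$-far from $k$-juntas. The $O$ and $\Omega$ hide absolute constants; logarithms are base 2. *)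

theory Defs
  imports "HOL-Probability.Probability"
begin

definition cube :: "nat \<Rightarrow> bool list set" where
  "cube n = {x. length x = n}"

text \<open>A function on the \<open>n\<close>-cube is a \<open>bool list \<Rightarrow> bool\<close> of which only the values on
  \<open>cube n\<close> matter.\<close>

definition depends_on :: "nat \<Rightarrow> (bool list \<Rightarrow> bool) \<Rightarrow> nat \<Rightarrow> bool" where
  "depends_on n f i \<longleftrightarrow> (\<exists>x \<in> cube n. f (x[i := \<not> x ! i]) \<noteq> f x)"

definition junta :: "nat \<Rightarrow> nat \<Rightarrow> (bool list \<Rightarrow> bool) \<Rightarrow> bool" where
  "junta n k f \<longleftrightarrow> card {i. i < n \<and> depends_on n f i} \<le> k"

definition fdist :: "nat \<Rightarrow> (bool list \<Rightarrow> bool) \<Rightarrow> (bool list \<Rightarrow> bool) \<Rightarrow> real" where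
  "fdist n f g = measure_pmf.prob (pmf_of_set (cube n)) {x. f x \<noteq> g x}"

definition close_to_junta :: "nat \<Rightarrow> nat \<Rightarrow> real \<Rightarrow> (bool list \<Rightarrow> bool) \<Rightarrow> bool" where
  "close_to_junta n k \<epsilon> f \<longleftrightarrow> (\<exists>g. junta n k g \<and> fdist n f g \<le> \<epsilon>)"

definition far_from_juntas :: "nat \<Rightarrow> nat \<Rightarrow> real \<Rightarrow> (bool list \<Rightarrow> bool) \<Rightarrow> bool" where
  "far_from_juntas n k \<epsilon> f \<longleftrightarrow> (\<forall>g. junta n k g \<longrightarrow> fdist n f g \<ge> \<epsilon>)"

text \<open>A deterministic adaptive query algorithm: each query point depends on the answers
  received so far, and a leaf carries the verdict (\<open>True\<close> is acceptance).\<close>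

datatype 'a query_alg = Output bool | Query 'a "bool \<Rightarrow> 'a query_alg"

primrec accepts :: "'a query_alg \<Rightarrow> ('a \<Rightarrow> bool) \<Rightarrow> bool" where
  "accepts (Output b) f = b"
| "accepts (Query x A) f = accepts (A (f x)) f"

primrec num_queries :: "'a query_alg \<Rightarrow> ('a \<Rightarrow> bool) \<Rightarrow> nat" where
  "num_queries (Output b) f = 0"
| "num_queries (Query x A) f = Suc (num_queries (A (f x)) f)"

text \<open>A randomized algorithm is a distribution over deterministic ones. A tester has to work
  for every number \<open>n\<close> of variables, which it is told in advance. The set
  \<open>set_query_alg A\<close> consists of all points that \<open>A\<close> can query.\<close>

type_synonym tester = "nat \<Rightarrow> bool list query_alg pmf"

definition tolerant_junta_tester :: "nat \<Rightarrow> real \<Rightarrow> real \<Rightarrow> tester \<Rightarrow> bool" where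
  "tolerant_junta_tester k \<epsilon>\<^sub>1 \<epsilon>\<^sub>2 T \<longleftrightarrow>
     (\<forall>n. (\<forall>A \<in> set_pmf (T n). set_query_alg A \<subseteq> cube n) \<and>
       (\<forall>f. close_to_junta n k \<epsilon>\<^sub>1 f \<longrightarrow>
              measure_pmf.prob (T n) {A. accepts A f} \<ge> 2 / 3) \<and>
       (\<forall>f. far_from_juntas n k \<epsilon>\<^sub>2 f \<longrightarrow>
              measure_pmf.prob (T n) {A. \<not> accepts A f} \<ge> 2 / 3))"

text \<open>Worst case over \<open>n\<close>, the input function and the internal randomness. The bound \<open>q\<close> must
  be uniform in \<open>n\<close>: for \<open>n \<le> k\<close> every function is a \<open>k\<close>-junta and no query is needed.\<close>

definition makes_at_most_queries :: "tester \<Rightarrow> nat \<Rightarrow> bool" where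
  "makes_at_most_queries T q \<longleftrightarrow>
     (\<forall>n. \<forall>A \<in> set_pmf (T n). \<forall>f. num_queries A f \<le> q)"

end

theory Submission
  imports Defs "HOL-Real_Asymp.Real_Asymp"
begin

text \<open>
  Put \<open>\<delta> = 1 - \<epsilon>\<^sub>1 / \<epsilon>\<^sub>2\<close>, \<open>l \<approx> log 2 (1 / \<delta>)\<close> and \<open>n = k + l\<close>, and fix a region \<open>G\<close> of the cube that is
  determined by the first \<open>t\<close> coordinates. A no-instance is uniformly random on \<open>G\<close> and zero outside;
  a yes-instance is uniformly random among those that are moreover invariant under simultaneously
  flipping the coordinates in a random set \<open>R\<close> of size \<open>l\<close>. A query algorithm can only tell them apart
  by querying two points that differ exactly in \<open>R\<close>, so by a union bound over pairs it needs about
  \<open>(n - t choose l)\<^bsup>1/2\<^esup> = k\<^bsup>\<Omega>(l)\<^esup>\<close> queries.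

  The best junta on \<open>n - l\<close> coordinates errs, on each of the \<open>2\<^sup>k\<close> subcubes that it leaves free, on the
  minority value. For a no-instance the minority is that of \<open>2\<^sup>l\<close> fair coins, for a yes-instance and
  the complement of \<open>R\<close> that of \<open>2\<^bsup>l - 1\<^esup>\<close> fair coins counted twice; the relative difference is at
  least of order \<open>2\<^bsup>- l\<^esup>\<close>. Both errors are concentrated, as the subcubes are independent. The density
  of \<open>G\<close> is chosen so that the two errors end up on either side of \<open>\<epsilon>\<^sub>1\<close> and \<open>\<epsilon>\<^sub>2\<close>.
\<close>

section \<open>Averages over random subsets\<close>

text \<open>\<open>bin_avg h g b\<close> is the expectation of \<open>h (b + Y)\<close> for \<open>Y\<close> binomial with parameters \<open>g\<close> and \<open>1/2\<close>.\<close>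

fun bin_avg :: "(nat \<Rightarrow> real) \<Rightarrow> nat \<Rightarrow> nat \<Rightarrow> real" where
  "bin_avg h 0 b = h b"
| "bin_avg h (Suc g) b = (bin_avg h g b + bin_avg h g (Suc b)) / 2"

lemma sum_Pow_insert:
  fixes f :: "'a set \<Rightarrow> 'b::comm_monoid_add"
  assumes "finite S" "x \<notin> S"
  shows "(\<Sum>P\<in>Pow (insert x S). f P) = (\<Sum>P\<in>Pow S. f P) + (\<Sum>P\<in>Pow S. f (insert x P))"
proof -
  have "inj_on (insert x) (Pow S)"
    using assms(2) by (intro inj_onI) (metis PowD insert_ident subsetD)
  moreover have "Pow S \<inter> insert x ` Pow S = {}"
    using assms(2) by auto
  ultimately show ?thesis
    using assms(1) by (simp add: Pow_insert sum.union_disjoint sum.reindex)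
qed

text \<open>Deciding one element at a time matches the recursion of \<open>bin_avg\<close>; the
  offset \<open>b\<close> counts the elements already chosen.\<close>

lemma sum_Pow_eq_bin_avg:
  assumes "finite S"
  shows "(\<Sum>P\<in>Pow S. h (card P + b)) = 2 ^ card S * bin_avg h (card S) b"
  using assms
proof (induction S arbitrary: b rule: finite_induct)
  case (insert x S)
  have "(\<Sum>P\<in>Pow S. h (card (insert x P) + b)) = (\<Sum>P\<in>Pow S. h (card P + Suc b))"
    using insert.hyps by (intro sum.cong) (auto simp: card_insert_if finite_subset)
  then show ?case
    using insert.IH[of b] insert.IH[of "Suc b"] insert.hyps
    by (simp add: sum_Pow_insert algebra_simps)
qed simp

lemma bin_avg_shift: "bin_avg (\<lambda>w. h (w + a)) g b = bin_avg h g (b + a)"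
  by (induction g arbitrary: b) auto

lemma bin_avg_add: "bin_avg (\<lambda>c. h c + h' c) g b = bin_avg h g b + bin_avg h' g b"
  by (induction g arbitrary: b) (auto simp: field_simps)

lemma bin_avg_cmult: "bin_avg (\<lambda>c. r * h c) g b = r * bin_avg h g b"
  by (induction g arbitrary: b) (auto simp: field_simps)

lemma bin_avg_const: "bin_avg (\<lambda>c. r) g b = r"
  by (induction g arbitrary: b) auto

lemma bin_avg_mono: "(\<And>c. c \<le> b + g \<Longrightarrow> h c \<le> h' c) \<Longrightarrow> bin_avg h g b \<le> bin_avg h' g b"
proof (induction g arbitrary: b)
  case (Suc g)
  have "bin_avg h g b \<le> bin_avg h' g b" "bin_avg h g (Suc b) \<le> bin_avg h' g (Suc b)"
    using Suc.prems by (intro Suc.IH; simp)+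
  then show ?case by simp
qed simp

lemma bin_avg_plus: "bin_avg h (g + g') b = bin_avg (\<lambda>c. bin_avg h g' c) g b"
  by (induction g arbitrary: b) auto

lemma bin_avg_linear: "bin_avg real g b = real b + real g / 2"
  by (induction g arbitrary: b) (auto simp: field_simps)

lemma bin_avg_square:
  "bin_avg (\<lambda>w. (real w - c)\<^sup>2) g b = (real b + real g / 2 - c)\<^sup>2 + real g / 4"
proof (induction g arbitrary: b)
  case (Suc g)
  show ?case
    unfolding bin_avg.simps Suc.IH by (simp add: field_simps power2_eq_square)
qed simp

text \<open>Condition on all coins but one: at most one outcome of the last coin hits the value
  \<open>p / 2\<close>.\<close>

lemma bin_avg_point_le_half: "bin_avg (\<lambda>w. if 2 * w = p then 1 else 0) (Suc g) b \<le> 1 / 2"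
proof -
  have "bin_avg (\<lambda>w. if 2 * w = p then 1 else 0) (Suc g) b
      = bin_avg (\<lambda>c. bin_avg (\<lambda>w. if 2 * w = p then 1 else 0) 1 c) g b"
    using bin_avg_plus[of _ g 1 b] by simp
  also have "\<dots> \<le> bin_avg (\<lambda>c. 1 / 2) g b"
    by (rule bin_avg_mono) auto
  finally show ?thesis by (simp add: bin_avg_const)
qed

text \<open>Complementing the random subset preserves the uniform distribution.\<close>

lemma bin_avg_reflect: "bin_avg (\<lambda>w. h (g - w)) g 0 = bin_avg h g 0"
proof -
  have "(\<Sum>P\<in>Pow {..<g}. h (g - card P)) = (\<Sum>P\<in>Pow {..<g}. h (card P))"
    by (rule sum.reindex_bij_witness[of _ "\<lambda>P. {..<g} - P" "\<lambda>P. {..<g} - P"])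
       (auto simp: card_Diff_subset finite_subset double_diff)
  then show ?thesis
    using sum_Pow_eq_bin_avg[of "{..<g}" "\<lambda>w. h (g - w)" 0]
      sum_Pow_eq_bin_avg[of "{..<g}" h 0] by simp
qed

lemma bin_avg_concave:
  assumes "\<And>b. h b + h (b + 2) \<le> 2 * h (b + 1)"
  shows "bin_avg h g b + bin_avg h g (b + 2) \<le> 2 * bin_avg h g (b + 1)"
proof (induction g arbitrary: b)
  case (Suc g)
  show ?case using Suc.IH[of b] Suc.IH[of "Suc b"] by (simp add: field_simps)
qed (use assms in simp)

text \<open>For a concave sequence with nonnegative start the chord slope \<open>a g / g\<close> is
  nonincreasing. The form without division admits \<open>g = 0\<close>.\<close>

lemma concave_seq_ratio:
  fixes a :: "nat \<Rightarrow> real"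
  assumes conc: "\<And>g. a g + a (g + 2) \<le> 2 * a (g + 1)" and "a 0 \<ge> 0" "g \<le> m"
  shows "real g * a m \<le> real m * a g"
proof -
  have step: "real g * a (Suc g) \<le> real (Suc g) * a g" for g
  proof (induction g)
    case (Suc g)
    have "real (Suc g) * (a g + a (g + 2)) \<le> real (Suc g) * (2 * a (g + 1))"
      by (intro mult_left_mono conc) auto
    then show ?case using Suc by (simp add: algebra_simps)
  qed (use assms in simp)
  show ?thesis
    using \<open>g \<le> m\<close>
  proof (induction m rule: dec_induct)
    case (step m)
    show ?case
    proof (cases "m = 0")
      case False
      have "real m * (real g * a (Suc m)) \<le> real g * (real (Suc m) * a m)"
        using mult_left_mono[OF \<open>\<And>g. real g * a (Suc g) \<le> real (Suc g) * a g\<close>[of m], of "real g"]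
        by (simp add: algebra_simps)
      also have "\<dots> = real (Suc m) * (real g * a m)" by simp
      also have "\<dots> \<le> real (Suc m) * (real m * a g)"
        by (intro mult_left_mono step.IH) auto
      finally have "real m * (real g * a (Suc m)) \<le> real m * (real (Suc m) * a g)"
        by (simp add: mult_ac)
      then show ?thesis using False by (simp add: mult_le_cancel_left_pos)
    qed (use step assms in simp)
  qed simp
qed

section \<open>Minority counts and their binomial averages\<close>

text \<open>The number of errors of the better constant on \<open>m\<close> points, \<open>w\<close>
  of which carry the value \<open>True\<close>.\<close>

definition minority :: "nat \<Rightarrow> nat \<Rightarrow> real" where
  "minority m w = min (real w) (real m - real w)"

lemma minority_concave: "minority m b + minority m (b + 2) \<le> 2 * minority m (b + 1)"
  unfolding minority_def by (simp add: min_def)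

text \<open>Since \<open>minority m\<close> is concave, so is its binomial average as a function of the number of coins.\<close>

lemma minority_partial_fill:
  assumes "g \<le> m"
  shows "real g * bin_avg (minority m) m 0 \<le> real m * bin_avg (minority m) g 0"
proof (rule concave_seq_ratio[OF _ _ assms])
  fix g
  show "bin_avg (minority m) g 0 + bin_avg (minority m) (g + 2) 0 \<le> 2 * bin_avg (minority m) (g + 1) 0"
    using bin_avg_concave[of "minority m" g 0, OF minority_concave] by (simp add: eval_nat_numeral field_simps)
qed (simp add: minority_def)

text \<open>The error per point of the best constant on a subcube of dimension \<open>l\<close> filled with fair coins.\<close>

definition minority_rate :: "nat \<Rightarrow> real" where
  "minority_rate l = bin_avg (minority (2 ^ l)) (2 ^ l) 0 / 2 ^ l"

lemma minority_rate_le_half: "minority_rate l \<le> 1 / 2"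
proof -
  have "bin_avg (minority (2 ^ l)) (2 ^ l) 0 \<le> bin_avg real (2 ^ l) 0"
    by (rule bin_avg_mono) (simp add: minority_def)
  then show ?thesis by (simp add: minority_rate_def bin_avg_linear field_simps)
qed

text \<open>The minority falls short of \<open>M / 2\<close> by the absolute deviation from the
  mean, which AM-GM bounds by a quadratic; its average involves only the variance
  \<open>M / 4\<close>. A bound beyond 0.49 leaves room for the largest admissible
  \<open>\<epsilon>\<^sub>2\<close>.\<close>

lemma minority_rate_ge:
  assumes "14 \<le> l"
  shows "minority_rate l \<ge> 0.495"
proof -
  define M :: real where "M = 2 ^ l"
  have "(2::real) ^ 14 \<le> M" unfolding M_def by (rule power_increasing) (use assms in auto)
  then have M: "M \<ge> 10000" by simp
  \<comment> \<open>With the weight \<open>100 / M\<close> the additive loss is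
    \<open>M / 400\<close>, and the averaged quadratic costs 25, at most another
    \<open>M / 400\<close>.\<close>
  have "M / 2 - M / 400 - 100 / M * (real w - M / 2)\<^sup>2 \<le> minority (2 ^ l) w" for w
  proof -
    have "0 \<le> (\<bar>real w - M / 2\<bar> - M / 200)\<^sup>2" by simp
    then have "M / 100 * \<bar>real w - M / 2\<bar> \<le> (real w - M / 2)\<^sup>2 + (M / 200)\<^sup>2"
      by (simp add: power2_diff field_simps)
    then have "(100 / M) * (M / 100 * \<bar>real w - M / 2\<bar>)
        \<le> (100 / M) * ((real w - M / 2)\<^sup>2 + (M / 200)\<^sup>2)"
      using M by (intro mult_left_mono) auto
    then have "\<bar>real w - M / 2\<bar> \<le> 100 / M * (real w - M / 2)\<^sup>2 + M / 400"
      using M by (simp add: field_simps power2_eq_square)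
    then show ?thesis by (simp add: minority_def M_def abs_le_iff)
  qed
  then have "bin_avg (\<lambda>w. (M / 2 - M / 400) + (- 100 / M) * (real w - M / 2)\<^sup>2) (2 ^ l) 0
      \<le> bin_avg (minority (2 ^ l)) (2 ^ l) 0"
    by (intro bin_avg_mono) (simp add: algebra_simps)
  then have "(M / 2 - M / 400) + (- 100 / M) * (M / 4) \<le> M * minority_rate l"
    unfolding bin_avg_add bin_avg_cmult bin_avg_const bin_avg_square
    by (simp add: minority_rate_def M_def)
  moreover have "(M / 2 - M / 400) + (- 100 / M) * (M / 4) = M * 199 / 400 - 25"
    using M by (simp add: field_simps)
  ultimately have "M * (99 / 200) \<le> M * minority_rate l" using M by linarith
  then have "99 / 200 \<le> minority_rate l" using M by (subst (asm) mult_le_cancel_left_pos) auto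
  then show ?thesis by simp
qed

lemma minority_superadditive: "minority p a + minority p b \<le> minority (2 * p) (a + b)"
  unfolding minority_def by auto

text \<open>The two halves have opposite strict majorities, so a common constant must overrule one
  of them; by integrality this costs at least one more error.\<close>

lemma minority_superadditive_strict:
  assumes "2 * a < p" "p < 2 * b"
  shows "minority p a + minority p b + 1 \<le> minority (2 * p) (a + b)"
proof -
  have "2 * real a + 1 \<le> real p" "real p + 1 \<le> 2 * real b"
    using assms by linarith+
  then show ?thesis unfolding minority_def by auto
qed

text \<open>The two tails are equal by reflection, and the midpoint carries at most half of the
  mass.\<close>

lemma bin_avg_tails:
  assumes "0 < p"
  shows "bin_avg (\<lambda>w. if 2 * w < p then 1 else 0) p 0 \<ge> 1 / 4"
    and "bin_avg (\<lambda>w. if p < 2 * w then 1 else 0) p 0 \<ge> 1 / 4"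
proof -
  let ?lo = "\<lambda>w::nat. if 2 * w < p then 1 else (0::real)"
  let ?hi = "\<lambda>w::nat. if p < 2 * w then 1 else (0::real)"
  let ?mid = "\<lambda>w::nat. if 2 * w = p then 1 else (0::real)"
  have "bin_avg ?hi p 0 = bin_avg (\<lambda>w. ?hi (p - w)) p 0" by (rule bin_avg_reflect[symmetric])
  also have "\<dots> = bin_avg ?lo p 0"
    by (intro antisym bin_avg_mono) auto
  finally have eq: "bin_avg ?hi p 0 = bin_avg ?lo p 0" .
  have "(\<lambda>w. ?lo w + ?hi w + ?mid w) = (\<lambda>w. 1)" by auto
  then have "bin_avg ?lo p 0 + bin_avg ?hi p 0 + bin_avg ?mid p 0 = 1"
    unfolding bin_avg_add[symmetric] by (simp add: bin_avg_const)
  moreover have "bin_avg ?mid p 0 \<le> 1 / 2"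
    using bin_avg_point_le_half[of p "p - 1" 0] assms by simp
  ultimately show "bin_avg ?lo p 0 \<ge> 1 / 4" "bin_avg ?hi p 0 \<ge> 1 / 4"
    using eq by linarith+
qed

text \<open>Split the \<open>2 ^ Suc l\<close> coins into two halves. With probability at least
  \<open>1 / 4 * (1 / 4)\<close> the first has a strict majority of zeros and the second one of
  ones, and then a common constant makes at least one extra error.\<close>

lemma minority_rate_gap: "minority_rate l + 1 / (16 * 2 ^ Suc l) \<le> minority_rate (Suc l)"
proof -
  define p :: nat where "p = 2 ^ l"
  let ?lo = "\<lambda>w::nat. if 2 * w < p then 1 else (0::real)"
  let ?hi = "\<lambda>w::nat. if p < 2 * w then 1 else (0::real)"
  have p: "0 < p" by (simp add: p_def)
  let ?m = "bin_avg (minority p) p 0"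
  have pt: "minority p a + minority p b + ?lo a * ?hi b \<le> minority (2 * p) (b + a)" for a b
    using minority_superadditive[of p a b] minority_superadditive_strict[of a p b]
    by (auto simp: add.commute)
  have "minority p a + ?m + ?lo a * bin_avg ?hi p 0 \<le> bin_avg (minority (2 * p)) p a" for a
  proof -
    have "bin_avg (\<lambda>b. minority p a + minority p b + ?lo a * ?hi b) p 0
        \<le> bin_avg (\<lambda>b. minority (2 * p) (b + a)) p 0"
      by (rule bin_avg_mono) (rule pt)
    then show ?thesis
      unfolding bin_avg_add bin_avg_cmult bin_avg_const bin_avg_shift by simp
  qed
  then have "bin_avg (\<lambda>a. minority p a + ?m + bin_avg ?hi p 0 * ?lo a) p 0
      \<le> bin_avg (\<lambda>a. bin_avg (minority (2 * p)) p a) p 0"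
    by (intro bin_avg_mono) (simp add: mult.commute)
  then have "?m + ?m + bin_avg ?hi p 0 * bin_avg ?lo p 0 \<le> bin_avg (minority (2 * p)) (p + p) 0"
    unfolding bin_avg_plus by (simp only: bin_avg_add bin_avg_cmult bin_avg_const)
  moreover have "1 / 4 * (1 / 4) \<le> bin_avg ?hi p 0 * bin_avg ?lo p 0"
    using bin_avg_tails[OF p] by (intro mult_mono) auto
  ultimately have "2 * ?m + 1 / 16 \<le> bin_avg (minority (2 * p)) (2 * p) 0"
    unfolding mult_2[of p, symmetric] by linarith
  then have "(2 * ?m + 1 / 16) / (2 * real p) \<le> bin_avg (minority (2 * p)) (2 * p) 0 / (2 * real p)"
    using p by (intro divide_right_mono) auto
  moreover have "(2 * ?m + 1 / 16) / (2 * real p) = minority_rate l + 1 / (16 * 2 ^ Suc l)"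
    unfolding minority_rate_def p_def by (simp add: field_simps)
  moreover have "minority_rate (Suc l) = bin_avg (minority (2 * p)) (2 * p) 0 / (2 * real p)"
    by (simp only: minority_rate_def p_def power_Suc of_nat_power of_nat_numeral)
  ultimately show ?thesis by linarith
qed

section \<open>Independent choices on disjoint blocks\<close>

text \<open>For disjoint blocks with \<open>\<P> i\<close> consisting of subsets of
  \<open>B i\<close>, a uniformly random member has independent uniform traces on the blocks.
  Product distributions are thus handled by counting.\<close>

definition blockwise :: "'i set \<Rightarrow> ('i \<Rightarrow> 'a set) \<Rightarrow> ('i \<Rightarrow> 'a set set) \<Rightarrow> 'a set set" where
  "blockwise I B \<P> = {F. F \<subseteq> (\<Union>i\<in>I. B i) \<and> (\<forall>i\<in>I. F \<inter> B i \<in> \<P> i)}"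

text \<open>Independence in counting form: a member corresponds to its tuple of traces, and a sum of
  products over tuples factorizes.\<close>

lemma sum_blockwise_prod:
  fixes g :: "'i \<Rightarrow> 'a set \<Rightarrow> real"
  assumes "finite I" "disjoint_family_on B I"
    and "\<And>i. i \<in> I \<Longrightarrow> finite (B i)" and sub: "\<And>i. i \<in> I \<Longrightarrow> \<P> i \<subseteq> Pow (B i)"
  shows "(\<Sum>F\<in>blockwise I B \<P>. \<Prod>i\<in>I. g i (F \<inter> B i)) = (\<Prod>i\<in>I. \<Sum>P\<in>\<P> i. g i P)"
proof -
  have fin: "finite (\<P> i)" if "i \<in> I" for i
    using assms(3)[OF that] sub[OF that] by (meson finite_Pow_iff finite_subset)
  have union_Int: "(\<Union>j\<in>I. S j) \<inter> B i = S i" if S: "S \<in> PiE I \<P>" and i: "i \<in> I" for S i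
  proof
    show "(\<Union>j\<in>I. S j) \<inter> B i \<subseteq> S i"
    proof
      fix x assume x: "x \<in> (\<Union>j\<in>I. S j) \<inter> B i"
      then obtain j where j: "j \<in> I" "x \<in> S j" by auto
      then have "x \<in> B j" using S sub by (auto simp: PiE_iff)
      then have "j = i" using x j i assms(2) by (auto simp: disjoint_family_on_def)
      then show "x \<in> S i" using j by simp
    qed
    show "S i \<subseteq> (\<Union>j\<in>I. S j) \<inter> B i" using S i sub by (auto simp: PiE_iff)
  qed
  have "(\<Sum>F\<in>blockwise I B \<P>. \<Prod>i\<in>I. g i (F \<inter> B i)) = (\<Sum>S\<in>PiE I \<P>. \<Prod>i\<in>I. g i (S i))"
  proof (rule sum.reindex_bij_witness
      [of _ "\<lambda>S. \<Union>j\<in>I. S j" "\<lambda>F. restrict (\<lambda>i. F \<inter> B i) I"])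
    fix S assume S: "S \<in> PiE I \<P>"
    show "restrict (\<lambda>i. (\<Union>j\<in>I. S j) \<inter> B i) I = S"
    proof
      fix i
      show "restrict (\<lambda>i. (\<Union>j\<in>I. S j) \<inter> B i) I i = S i"
        using union_Int[OF S, of i] PiE_arb[OF S, of i] by (cases "i \<in> I") simp_all
    qed
    have "(\<Union>j\<in>I. S j) \<subseteq> (\<Union>i\<in>I. B i)"
      using S sub by (fastforce simp: PiE_iff)
    then show "(\<Union>j\<in>I. S j) \<in> blockwise I B \<P>"
      using S union_Int[OF S] by (auto simp: blockwise_def PiE_iff)
  qed (auto simp: blockwise_def)
  also have "\<dots> = (\<Prod>i\<in>I. \<Sum>P\<in>\<P> i. g i P)"
    by (rule prod_sum_PiE[symmetric]) (use assms fin in auto)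
  finally show ?thesis .
qed

section \<open>Exponential moments and a Chernoff bound\<close>

lemma exp_le_quadratic:
  fixes x :: real
  assumes "\<bar>x\<bar> \<le> 1"
  shows "exp x \<le> 1 + x + x\<^sup>2"
proof (cases "0 \<le> x")
  case True
  then show ?thesis using exp_bound[of x] assms by simp
next
  case False
  define y where "y = - x"
  have y: "0 \<le> y" "y \<le> 1" using False assms by (auto simp: y_def)
  have "1 + y + y\<^sup>2 / 2 \<le> exp y" using exp_lower_Taylor_quadratic[of y] y by simp
  then have "inverse (exp y) \<le> inverse (1 + y + y\<^sup>2 / 2)"
    using y by (intro le_imp_inverse_le) (auto simp: add_pos_nonneg)
  also have "\<dots> \<le> 1 - y + y\<^sup>2"
  proof -
    \<comment> \<open>This is exactly the excess over 1 of the product in the next line.\<close>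
    have "0 \<le> y\<^sup>2 * (1 + y + y\<^sup>2) / 2" using y by simp
    then have "1 \<le> (1 - y + y\<^sup>2) * (1 + y + y\<^sup>2 / 2)"
      by (simp add: field_simps power2_eq_square power3_eq_cube)
    then show ?thesis
      using y by (simp add: inverse_eq_divide divide_le_eq add_pos_nonneg)
  qed
  finally show ?thesis by (simp add: y_def exp_minus)
qed

text \<open>In the quadratic bound for \<open>exp\<close> the linear term averages to zero, and the
  squared deviation is at most 1.\<close>

lemma mgf_le:
  fixes X :: "'b \<Rightarrow> real"
  assumes "finite A" "A \<noteq> {}" and X: "\<And>a. a \<in> A \<Longrightarrow> 0 \<le> X a \<and> X a \<le> 1"
    and \<mu>: "\<mu> = (\<Sum>a\<in>A. X a) / card A" and \<theta>: "0 \<le> \<theta>" "\<theta> \<le> 1"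
  shows "(\<Sum>a\<in>A. exp (\<theta> * (X a - \<mu>))) \<le> card A * exp (\<theta>\<^sup>2)"
proof -
  have pos: "real (card A) > 0" using assms by (simp add: card_gt_0_iff)
  have sumX: "(\<Sum>a\<in>A. X a) = card A * \<mu>" using pos \<mu> by simp
  have "0 \<le> (\<Sum>a\<in>A. X a)" "(\<Sum>a\<in>A. X a) \<le> real (card A) * 1"
    using X by (blast intro: sum_nonneg, intro sum_bounded_above) auto
  then have \<mu>01: "0 \<le> \<mu>" "\<mu> \<le> 1" using pos by (auto simp: \<mu> divide_le_eq)
  have "exp (\<theta> * (X a - \<mu>)) \<le> 1 + \<theta> * (X a - \<mu>) + \<theta>\<^sup>2" if "a \<in> A" for a
  proof -
    have d: "\<bar>X a - \<mu>\<bar> \<le> 1" using X[OF that] \<mu>01 by auto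
    then have "\<bar>\<theta> * (X a - \<mu>)\<bar> \<le> 1" unfolding abs_mult using \<theta> mult_le_one by fastforce
    then have "exp (\<theta> * (X a - \<mu>)) \<le> 1 + \<theta> * (X a - \<mu>) + (\<theta> * (X a - \<mu>))\<^sup>2"
      by (rule exp_le_quadratic)
    moreover have "(X a - \<mu>)\<^sup>2 \<le> 1" using d by (simp add: abs_square_le_1)
    then have "(\<theta> * (X a - \<mu>))\<^sup>2 \<le> \<theta>\<^sup>2"
      by (simp add: power_mult_distrib mult_left_le)
    ultimately show ?thesis by linarith
  qed
  then have "(\<Sum>a\<in>A. exp (\<theta> * (X a - \<mu>))) \<le> (\<Sum>a\<in>A. (1 + \<theta>\<^sup>2 - \<theta> * \<mu>) + \<theta> * X a)"
    by (intro sum_mono) (simp add: algebra_simps)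
  also have "\<dots> = card A * (1 + \<theta>\<^sup>2)"
    by (simp add: sum.distrib sumX flip: sum_distrib_left) (simp add: algebra_simps)
  also have "\<dots> \<le> card A * exp (\<theta>\<^sup>2)"
    using exp_ge_add_one_self[of "\<theta>\<^sup>2"] by (intro mult_left_mono) auto
  finally show ?thesis .
qed

text \<open>Markov's inequality for the exponential of the centred sum, whose average factorizes
  over the blocks.\<close>

lemma blockwise_chernoff:
  fixes X :: "'i \<Rightarrow> 'a set \<Rightarrow> real" and m s :: real
  assumes I: "finite I" and disj: "disjoint_family_on B I"
    and finB: "\<And>i. i \<in> I \<Longrightarrow> finite (B i)" and sub: "\<And>i. i \<in> I \<Longrightarrow> \<P> i \<subseteq> Pow (B i)"
    and ne: "\<And>i. i \<in> I \<Longrightarrow> \<P> i \<noteq> {}"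
    and X: "\<And>i P. i \<in> I \<Longrightarrow> P \<in> \<P> i \<Longrightarrow> 0 \<le> X i P \<and> X i P \<le> 1"
    and m: "(\<Sum>i\<in>I. (\<Sum>P\<in>\<P> i. X i P) / card (\<P> i)) \<le> m"
    and s: "0 \<le> s" "s \<le> 1"
  shows "real (card {F \<in> blockwise I B \<P>. m + s * card I \<le> (\<Sum>i\<in>I. X i (F \<inter> B i))})
    \<le> exp (- s\<^sup>2 * card I / 4) * card (blockwise I B \<P>)"
proof -
  define \<mu> where "\<mu> i = (\<Sum>P\<in>\<P> i. X i P) / card (\<P> i)" for i
  \<comment> \<open>This value minimizes the exponent \<open>\<theta>\<^sup>2 - \<theta> * s\<close>
    contributed by each block, giving \<open>- s\<^sup>2 / 4\<close>.\<close>
  define \<theta> where "\<theta> = s / 2"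
  have \<theta>: "0 \<le> \<theta>" "\<theta> \<le> 1" using s by (auto simp: \<theta>_def)
  let ?\<F> = "blockwise I B \<P>"
  let ?bad = "{F \<in> ?\<F>. m + s * card I \<le> (\<Sum>i\<in>I. X i (F \<inter> B i))}"
  have finF: "finite ?\<F>"
    by (rule finite_subset[of _ "Pow (\<Union>i\<in>I. B i)"]) (use I finB in \<open>auto simp: blockwise_def\<close>)
  have finP: "finite (\<P> i)" if "i \<in> I" for i
    using finB[OF that] sub[OF that] by (meson finite_Pow_iff finite_subset)
  have cardF: "real (card ?\<F>) = (\<Prod>i\<in>I. real (card (\<P> i)))"
    using sum_blockwise_prod[OF I disj finB sub, of "\<lambda>_ _. 1"] by simp
  have "real (card ?bad) * exp (\<theta> * s * card I) = (\<Sum>F\<in>?bad. exp (\<theta> * s * card I))" by simp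
  also have "\<dots> \<le> (\<Sum>F\<in>?bad. \<Prod>i\<in>I. exp (\<theta> * (X i (F \<inter> B i) - \<mu> i)))"
  proof (rule sum_mono)
    fix F assume F: "F \<in> ?bad"
    have "s * card I \<le> (\<Sum>i\<in>I. X i (F \<inter> B i) - \<mu> i)"
      using F m by (simp add: sum_subtractf \<mu>_def)
    then have "\<theta> * (s * card I) \<le> \<theta> * (\<Sum>i\<in>I. X i (F \<inter> B i) - \<mu> i)"
      using \<theta> by (intro mult_left_mono) auto
    then show "exp (\<theta> * s * card I) \<le> (\<Prod>i\<in>I. exp (\<theta> * (X i (F \<inter> B i) - \<mu> i)))"
      using I by (simp add: sum_distrib_left mult.assoc flip: exp_sum)
  qed
  also have "\<dots> \<le> (\<Sum>F\<in>?\<F>. \<Prod>i\<in>I. exp (\<theta> * (X i (F \<inter> B i) - \<mu> i)))"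
    using finF by (intro sum_mono2) (auto intro!: prod_nonneg)
  also have "\<dots> = (\<Prod>i\<in>I. \<Sum>P\<in>\<P> i. exp (\<theta> * (X i P - \<mu> i)))"
    by (rule sum_blockwise_prod[OF I disj finB sub])
  also have "\<dots> \<le> (\<Prod>i\<in>I. card (\<P> i) * exp (\<theta>\<^sup>2))"
    using finP ne X \<theta> by (intro prod_mono conjI mgf_le sum_nonneg) (auto simp: \<mu>_def)
  also have "\<dots> = card ?\<F> * exp (card I * \<theta>\<^sup>2)"
    by (simp add: prod.distrib cardF exp_of_nat_mult)
  finally have "real (card ?bad) \<le> card ?\<F> * exp (card I * \<theta>\<^sup>2) / exp (\<theta> * s * card I)"
    by (simp add: field_simps)
  also have "\<dots> = exp (- s\<^sup>2 * card I / 4) * card ?\<F>"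
    by (simp add: exp_diff[symmetric] \<theta>_def power2_eq_square field_simps flip: exp_minus exp_add)
  finally show ?thesis .
qed

section \<open>Query algorithms against flip-invariant functions\<close>

definition flip :: "'a set \<Rightarrow> 'a set \<Rightarrow> 'a set" where
  "flip R x = (x - R) \<union> (R - x)"

lemma flip_flip [simp]: "flip R (flip R x) = x"
  by (auto simp: flip_def)

lemma flip_neq: "R \<noteq> {} \<Longrightarrow> flip R x \<noteq> x"
  by (auto simp: flip_def)

text \<open>Points of the cube are sets of coordinates, and Boolean functions are sets of points.\<close>

definition flip_invariant :: "'a set set \<Rightarrow> 'a set \<Rightarrow> 'a set set set" where
  "flip_invariant G R = {F. F \<subseteq> G \<and> (\<forall>x\<in>F. flip R x \<in> F)}"

lemma flip_invariant_iff: "F \<in> flip_invariant G R \<Longrightarrow> flip R x \<in> F \<longleftrightarrow> x \<in> F"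
  unfolding flip_invariant_def using flip_flip[of R x] by (metis (mono_tags, lifting) mem_Collect_eq)

lemma finite_flip_invariant: "finite G \<Longrightarrow> finite (flip_invariant G R)"
  by (rule finite_subset[of _ "Pow G"]) (auto simp: flip_invariant_def)

text \<open>\<open>W\<close> will be the set of queried points. While it contains no two partners
  under \<open>flip R\<close>, a random invariant function looks uniform on it.\<close>

definition unpaired :: "'a set \<Rightarrow> 'a set set \<Rightarrow> bool" where
  "unpaired R W \<longleftrightarrow> (\<forall>x\<in>W. flip R x \<notin> W)"

text \<open>On an unpaired set the values are independent fair coins: toggling a new point together
  with its partner is a bijection between the members with and without it, and does not touch the
  trace on \<open>W\<close>.\<close>

lemma flip_invariant_prescribed:
  assumes G: "finite G" "\<And>x. x \<in> G \<Longrightarrow> flip R x \<in> G" and "R \<noteq> {}"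
    and "finite W" "W \<subseteq> G" "unpaired R W" "a \<subseteq> W"
  shows "card {F \<in> flip_invariant G R. F \<inter> W = a} * 2 ^ card W = card (flip_invariant G R)"
  using assms(4-)
proof (induction W arbitrary: a rule: finite_induct)
  case (insert x W)
  let ?Y = "flip_invariant G R" and ?b = "a \<inter> W"
  let ?in = "{F \<in> ?Y. F \<inter> W = ?b \<and> x \<in> F}" and ?out = "{F \<in> ?Y. F \<inter> W = ?b \<and> x \<notin> F}"
  have fin: "finite ?Y" by (rule finite_flip_invariant[OF G(1)])
  have xW: "flip R x \<notin> W" "x \<in> G" "flip R x \<in> G"
    using insert.prems G(2) by (auto simp: unpaired_def)
  have "bij_betw (\<lambda>F. F - {x, flip R x}) ?in ?out"
  proof (rule bij_betw_byWitness[where f' = "\<lambda>F. F \<union> {x, flip R x}"])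
    have flip_eq: "flip R z = x \<longleftrightarrow> z = flip R x" "flip R z = flip R x \<longleftrightarrow> z = x" for z
      by (metis flip_flip)+
    show "(\<lambda>F. F - {x, flip R x}) ` ?in \<subseteq> ?out"
    proof (rule image_subsetI)
      fix F assume F: "F \<in> ?in"
      then have "F - {x, flip R x} \<in> ?Y"
        unfolding flip_invariant_def by (simp add: flip_eq) blast
      then show "F - {x, flip R x} \<in> ?out" using F xW insert.hyps by blast
    qed
    show "(\<lambda>F. F \<union> {x, flip R x}) ` ?out \<subseteq> ?in"
    proof (rule image_subsetI)
      fix F assume F: "F \<in> ?out"
      then have "F \<union> {x, flip R x} \<in> ?Y"
        unfolding flip_invariant_def using xW by simp
      then show "F \<union> {x, flip R x} \<in> ?in" using F xW insert.hyps by blast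
    qed
    show "\<forall>F\<in>?in. F - {x, flip R x} \<union> {x, flip R x} = F"
      using flip_invariant_iff[of _ G R x] by blast
    show "\<forall>F\<in>?out. F \<union> {x, flip R x} - {x, flip R x} = F"
      using flip_invariant_iff[of _ G R x] by blast
  qed
  then have "card ?in = card ?out" by (rule bij_betw_same_card)
  moreover have "card {F \<in> ?Y. F \<inter> W = ?b} = card ?in + card ?out"
    using fin by (subst card_Un_disjoint[symmetric]) (auto intro!: arg_cong[where f=card])
  moreover have "{F \<in> ?Y. F \<inter> insert x W = a} = (if x \<in> a then ?in else ?out)"
    using insert.prems insert.hyps by auto
  ultimately have "card {F \<in> ?Y. F \<inter> W = ?b} = 2 * card {F \<in> ?Y. F \<inter> insert x W = a}"
    by simp
  moreover have "card {F \<in> ?Y. F \<inter> W = ?b} * 2 ^ card W = card ?Y"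
    using insert.prems by (intro insert.IH) (auto simp: unpaired_def)
  ultimately show ?case using insert.hyps by simp
qed simp

lemma Pow_prescribed:
  assumes "finite G" "W \<subseteq> G" "a \<subseteq> W"
  shows "card {F \<in> Pow G. F \<inter> W = a} * 2 ^ card W = 2 ^ card G"
proof -
  have "bij_betw (\<lambda>F. F - W) {F \<in> Pow G. F \<inter> W = a} (Pow (G - W))"
    by (rule bij_betw_byWitness[where f' = "\<lambda>F. F \<union> a"]) (use assms in auto)
  then have "card {F \<in> Pow G. F \<inter> W = a} = 2 ^ (card G - card W)"
    using assms by (simp add: bij_betw_same_card card_Pow card_Diff_subset finite_subset)
  then show ?thesis
    using assms by (simp add: card_mono flip: power_add)
qed

section \<open>Adaptive queries and transcripts\<close>

text \<open>The map \<open>p\<close> carries query points, later bit lists, to points as sets;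
  \<open>W\<close> and \<open>a\<close> record a transcript.\<close>

definition rejecting :: "'b query_alg \<Rightarrow> ('b \<Rightarrow> 'a set) \<Rightarrow> 'a set set set \<Rightarrow> 'a set set \<Rightarrow> 'a set set
    \<Rightarrow> 'a set set set" where
  "rejecting A p \<F> W a = {F \<in> \<F>. F \<inter> W = a \<and> \<not> accepts A (\<lambda>x. p x \<in> F)}"

lemma Int_insertD:
  assumes "y \<notin> W" "a \<subseteq> W"
  shows "F \<inter> insert y W = insert y a \<Longrightarrow> y \<in> F \<and> F \<inter> W = a"
    and "F \<inter> insert y W = a \<Longrightarrow> y \<notin> F \<and> F \<inter> W = a"
proof -
  have *: "F \<inter> W = (F \<inter> insert y W) \<inter> W" by auto
  show "F \<inter> insert y W = insert y a \<Longrightarrow> y \<in> F \<and> F \<inter> W = a"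
    using assms by (subst *) auto
  show "F \<inter> insert y W = a \<Longrightarrow> y \<notin> F \<and> F \<inter> W = a"
    using assms by (subst *) auto
qed

lemma card_rejecting_Query:
  assumes "finite \<F>" "p x \<notin> W" "a \<subseteq> W"
  shows "card (rejecting (Query x A) p \<F> W a)
    = card (rejecting (A True) p \<F> (insert (p x) W) (insert (p x) a))
      + card (rejecting (A False) p \<F> (insert (p x) W) a)"
proof -
  have "rejecting (Query x A) p \<F> W a
    = rejecting (A True) p \<F> (insert (p x) W) (insert (p x) a)
      \<union> rejecting (A False) p \<F> (insert (p x) W) a" (is "?L = ?T \<union> ?F")
  proof (intro set_eqI iffI)
    fix F assume F: "F \<in> ?L"
    show "F \<in> ?T \<union> ?F"
    proof (cases "p x \<in> F")
      case True
      then have "F \<inter> insert (p x) W = insert (p x) (F \<inter> W)" by auto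
      then show ?thesis using F True by (auto simp: rejecting_def)
    next
      case False
      then have "F \<inter> insert (p x) W = F \<inter> W" by auto
      then show ?thesis using F False by (auto simp: rejecting_def)
    qed
  next
    fix F assume "F \<in> ?T \<union> ?F"
    then consider "F \<in> ?T" | "F \<in> ?F" by blast
    then show "F \<in> ?L"
    proof cases
      case 1
      then have "p x \<in> F \<and> F \<inter> W = a"
        by (intro Int_insertD(1)[OF assms(2,3)]) (simp add: rejecting_def)
      then show ?thesis using 1 by (simp add: rejecting_def)
    next
      case 2
      then have "p x \<notin> F \<and> F \<inter> W = a"
        by (intro Int_insertD(2)[OF assms(2,3)]) (simp add: rejecting_def)
      then show ?thesis using 2 by (simp add: rejecting_def)
    qed
  qed
  moreover have "?T \<inter> ?F = {}"
    using Int_insertD[OF assms(2,3)] unfolding rejecting_def by fast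
  moreover have "finite ?T" "finite ?F" using assms by (auto simp: rejecting_def)
  ultimately show ?thesis by (simp add: card_Un_disjoint)
qed

text \<open>The new point must be the flip of an old point \<open>w\<close>, and then
  \<open>R\<close> is the symmetric difference of the two, so \<open>w\<close> determines
  \<open>R\<close>.\<close>

lemma newly_paired_card:
  assumes "finite W" "\<And>R. R \<in> \<R> \<Longrightarrow> R \<noteq> {}"
  shows "card {R \<in> \<R>. unpaired R W \<and> \<not> unpaired R (insert y W)} \<le> card W"
proof -
  have "{R \<in> \<R>. unpaired R W \<and> \<not> unpaired R (insert y W)} \<subseteq> (\<lambda>w. flip w y) ` W"
  proof
    fix R assume R: "R \<in> {R \<in> \<R>. unpaired R W \<and> \<not> unpaired R (insert y W)}"
    then have neq: "flip R y \<noteq> y" using flip_neq[OF assms(2)] by simp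
    obtain z where z: "z \<in> insert y W" "flip R z \<in> insert y W"
      using R by (auto simp: unpaired_def)
    have "\<exists>w\<in>W. flip R w = y"
    proof (cases "z = y")
      case True
      then show ?thesis using z neq by (intro bexI[of _ "flip R y"]) auto
    next
      case False
      then show ?thesis using z R by (intro bexI[of _ z]) (auto simp: unpaired_def)
    qed
    then obtain w where w: "w \<in> W" "flip R w = y" by blast
    have "R = flip w (flip R w)" by (auto simp: flip_def)
    then show "R \<in> (\<lambda>w. flip w y) ` W" using w by simp
  qed
  then show ?thesis using assms(1) by (rule surj_card_le[rotated])
qed

text \<open>The algorithm has already queried the points \<open>W\<close> of \<open>G\<close>, and those in \<open>a\<close> have been answered by
  \<open>True\<close>. As long as \<open>W\<close> contains no pair differing in \<open>R\<close>, the answers of both kinds of instances are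
  fair coins, and a new query creates such a pair for at most \<open>card W\<close> of the sets \<open>R\<close>.\<close>

lemma query_indistinguishable_aux:
  fixes A :: "'b query_alg" and p :: "'b \<Rightarrow> 'a set"
  assumes G: "finite G" and fR: "finite \<R>" and ne: "\<And>R. R \<in> \<R> \<Longrightarrow> R \<noteq> {}"
    and cl: "\<And>R x. R \<in> \<R> \<Longrightarrow> x \<in> G \<Longrightarrow> flip R x \<in> G"
    and "W \<subseteq> G" "a \<subseteq> W"
    and "\<And>F. F \<subseteq> G \<Longrightarrow> F \<inter> W = a \<Longrightarrow> num_queries A (\<lambda>x. p x \<in> F) \<le> q"
  shows "(\<Sum>R | R \<in> \<R> \<and> unpaired R W.
      card (rejecting A p (Pow G) W a) / 2 ^ card G
      - card (rejecting A p (flip_invariant G R) W a) / card (flip_invariant G R))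
    \<le> q * (card W + q) / 2 ^ card W"
  using assms(5-)
proof (induction A arbitrary: q W a)
  case (Output b)
  have finW: "finite W" using Output.prems(1) G finite_subset by blast
  show ?case
  proof (cases b)
    case True
    then show ?thesis by (simp add: rejecting_def)
  next
    case False
    \<comment> \<open>At a rejecting leaf both proportions equal \<open>1 / 2 ^ card W\<close>, so
      every summand vanishes.\<close>
    have "card (rejecting (Output b) p (Pow G) W a) / 2 ^ card G = 1 / (2::real) ^ card W"
      using arg_cong[OF Pow_prescribed[OF G Output.prems(1,2)], of real] False
      by (simp add: rejecting_def field_simps)
    moreover have "card (rejecting (Output b) p (flip_invariant G R) W a)
        / card (flip_invariant G R) = 1 / (2::real) ^ card W"
      if "R \<in> \<R>" "unpaired R W" for R
    proof -
      have "{} \<in> flip_invariant G R" by (simp add: flip_invariant_def)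
      then have "card (flip_invariant G R) > 0"
        using finite_flip_invariant[OF G] card_gt_0_iff by blast
      then show ?thesis
        using arg_cong[OF flip_invariant_prescribed[OF G cl[OF that(1)] ne[OF that(1)] finW
            Output.prems(1) that(2) Output.prems(2)], of real] False
        by (simp add: rejecting_def field_simps)
    qed
    ultimately have "(\<Sum>R | R \<in> \<R> \<and> unpaired R W.
      card (rejecting (Output b) p (Pow G) W a) / 2 ^ card G
      - card (rejecting (Output b) p (flip_invariant G R) W a) / card (flip_invariant G R))
      = (\<Sum>R | R \<in> \<R> \<and> unpaired R W. 0::real)"
      by (intro sum.cong) auto
    then show ?thesis by simp
  qed
next
  case (Query x A)
  let ?y = "p x"
  let ?d = "\<lambda>A W a R. card (rejecting A p (Pow G) W a) / 2 ^ card G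
      - card (rejecting A p (flip_invariant G R) W a) / real (card (flip_invariant G R))"
  have finW: "finite W" using Query.prems(1) G finite_subset by blast
  have "a \<subseteq> G" "a \<inter> W = a" using Query.prems(1,2) by auto
  from Query.prems(3)[OF this] obtain q' where q: "q = Suc q'" by (cases q) auto
  have weaken: "real q' * (card W + q') / 2 ^ card W \<le> q * (card W + q) / 2 ^ card W"
    unfolding q by (intro divide_right_mono) (auto simp: algebra_simps)
  show ?case
  proof (cases "?y \<in> G \<and> ?y \<notin> W")
    \<comment> \<open>Outside \<open>G\<close> the answer is always \<open>False\<close>, and on
      \<open>W\<close> it is already recorded: such a query reveals nothing.\<close>
    case False
    have ans: "(p x \<in> F) = (?y \<in> a)" if "F \<subseteq> G" "F \<inter> W = a" for F
      using False that Query.prems(1,2) by blast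
    have "rejecting (Query x A) p \<F> W a = rejecting (A (?y \<in> a)) p \<F> W a"
      if "\<F> \<subseteq> Pow G" for \<F>
      unfolding rejecting_def
    proof (intro Collect_cong conj_cong refl)
      fix F assume "F \<in> \<F>" "F \<inter> W = a"
      then have "(p x \<in> F) = (?y \<in> a)" using ans[of F] that by blast
      then show "(\<not> accepts (Query x A) (\<lambda>x. p x \<in> F)) = (\<not> accepts (A (?y \<in> a)) (\<lambda>x. p x \<in> F))"
        by (simp only: accepts.simps)
    qed
    moreover have "flip_invariant G R \<subseteq> Pow G" for R by (auto simp: flip_invariant_def)
    ultimately have "(\<Sum>R | R \<in> \<R> \<and> unpaired R W. ?d (Query x A) W a R)
        = (\<Sum>R | R \<in> \<R> \<and> unpaired R W. ?d (A (?y \<in> a)) W a R)"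
      by (simp only: subset_refl)
    also have "\<dots> \<le> q' * (card W + q') / 2 ^ card W"
    proof (rule Query.IH)
      fix F assume F: "F \<subseteq> G" "F \<inter> W = a"
      show "num_queries (A (?y \<in> a)) (\<lambda>x. p x \<in> F) \<le> q'"
        using Query.prems(3)[OF F] unfolding num_queries.simps ans[OF F] q by simp
    qed (use Query.prems(1,2) in auto)
    finally show ?thesis using weaken by simp
  next
    case True
    let ?W = "insert ?y W"
    have cW: "card ?W = Suc (card W)" using True finW by simp
    \<comment> \<open>The sets that stay unpaired are passed to the induction hypothesis for both
      answers; those in \<open>?N\<close> become paired now and are given up.\<close>
    let ?U = "{R \<in> \<R>. unpaired R W}" and ?U' = "{R \<in> \<R>. unpaired R ?W}"
    let ?N = "{R \<in> \<R>. unpaired R W \<and> \<not> unpaired R ?W}"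
    have split: "?d (Query x A) W a R = ?d (A True) ?W (insert ?y a) R + ?d (A False) ?W a R" for R
      using True Query.prems(1,2) G finite_flip_invariant[OF G, of R]
      by (simp add: card_rejecting_Query add_divide_distrib)
    have s1: "(\<Sum>R\<in>?U. ?d (Query x A) W a R)
        = (\<Sum>R\<in>?U'. ?d (Query x A) W a R) + (\<Sum>R\<in>?N. ?d (Query x A) W a R)"
      using fR by (subst sum.union_disjoint[symmetric])
        (auto intro!: sum.cong simp: unpaired_def)
    have s2: "(\<Sum>R\<in>?N. ?d (Query x A) W a R) \<le> card W / 2 ^ card W"
    proof -
      have "real (card (rejecting (Query x A) p (Pow G) W a)) \<le> card {F \<in> Pow G. F \<inter> W = a}"
        using G by (intro of_nat_mono card_mono) (auto simp: rejecting_def)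
      also have "\<dots> = 2 ^ card G / 2 ^ card W"
        using arg_cong[OF Pow_prescribed[OF G Query.prems(1,2)], of real] by (simp add: field_simps)
      finally have "card (rejecting (Query x A) p (Pow G) W a) / 2 ^ card G \<le> 1 / (2::real) ^ card W"
        by (simp add: field_simps)
      \<comment> \<open>Only an upper bound is wanted, so the subtracted term is dropped.\<close>
      then have "?d (Query x A) W a R \<le> 1 / 2 ^ card W" for R
        by (rule order_trans[rotated]) simp
      then have "(\<Sum>R\<in>?N. ?d (Query x A) W a R) \<le> card ?N * (1 / 2 ^ card W)"
        by (intro sum_bounded_above) auto
      also have "\<dots> \<le> card W * (1 / 2 ^ card W)"
        using newly_paired_card[OF finW ne, of \<R> ?y] by (intro mult_right_mono) auto
      finally show ?thesis by simp
    qed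
    have s3: "(\<Sum>R\<in>?U'. ?d (Query x A) W a R)
        = (\<Sum>R\<in>?U'. ?d (A True) ?W (insert ?y a) R) + (\<Sum>R\<in>?U'. ?d (A False) ?W a R)"
      by (simp only: split sum.distrib)
    have s4: "(\<Sum>R\<in>?U'. ?d (A True) ?W (insert ?y a) R) \<le> q' * (card ?W + q') / 2 ^ card ?W"
    proof (rule Query.IH)
      fix F assume F: "F \<subseteq> G" "F \<inter> ?W = insert ?y a"
      have yF: "?y \<in> F \<and> F \<inter> W = a"
        using True by (intro Int_insertD(1)[OF _ Query.prems(2) F(2)]) simp
      show "num_queries (A True) (\<lambda>x. p x \<in> F) \<le> q'"
        using Query.prems(3)[OF F(1) conjunct2[OF yF]] conjunct1[OF yF] by (simp add: q)
    qed (use Query.prems(1,2) True in auto)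
    have s5: "(\<Sum>R\<in>?U'. ?d (A False) ?W a R) \<le> q' * (card ?W + q') / 2 ^ card ?W"
    proof (rule Query.IH)
      fix F assume F: "F \<subseteq> G" "F \<inter> ?W = a"
      have yF: "?y \<notin> F \<and> F \<inter> W = a"
        using True by (intro Int_insertD(2)[OF _ Query.prems(2) F(2)]) simp
      show "num_queries (A False) (\<lambda>x. p x \<in> F) \<le> q'"
        using Query.prems(3)[OF F(1) conjunct2[OF yF]] conjunct1[OF yF] by (simp add: q)
    qed (use Query.prems(1,2) True in auto)
    \<comment> \<open>The two branches compensate the halved weight \<open>1 / 2 ^ card ?W\<close>,
      and passing from \<open>q'\<close> to \<open>q\<close> leaves room for the
      \<open>card W\<close> sets that were given up.\<close>
    have s6: "real (q' * (card ?W + q')) / 2 ^ card ?W + real (q' * (card ?W + q')) / 2 ^ card ?W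
        + card W / 2 ^ card W = (q' * (card W + q) + card W) / 2 ^ card W"
      by (simp add: cW q field_simps)
    have s7: "(q' * (card W + q) + card W) / 2 ^ card W \<le> real (q * (card W + q)) / 2 ^ card W"
      unfolding q by (intro divide_right_mono) (auto simp: algebra_simps)
    show ?thesis using s1 s2 s3 s4 s5 s6 s7 by linarith
  qed
qed

text \<open>This direction suffices: a tester has to reject the uniform instances more often than
  the invariant ones.\<close>

lemma query_indistinguishable:
  fixes A :: "'b query_alg" and p :: "'b \<Rightarrow> 'a set"
  assumes "finite G" "finite \<R>" "\<And>R. R \<in> \<R> \<Longrightarrow> R \<noteq> {}"
    and "\<And>R x. R \<in> \<R> \<Longrightarrow> x \<in> G \<Longrightarrow> flip R x \<in> G"
    and "\<And>f. num_queries A f \<le> q"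
  shows "(\<Sum>R\<in>\<R>. card {F \<in> Pow G. \<not> accepts A (\<lambda>x. p x \<in> F)} / 2 ^ card G
      - card {F \<in> flip_invariant G R. \<not> accepts A (\<lambda>x. p x \<in> F)} / card (flip_invariant G R))
    \<le> (real q)\<^sup>2"
  using query_indistinguishable_aux[OF assms(1-4), of "{}" "{}" A p q] assms(5)
  by (simp add: rejecting_def unpaired_def power2_eq_square)

section \<open>Errors of juntas on random functions\<close>

definition block :: "'a set \<Rightarrow> 'a set \<Rightarrow> 'a set \<Rightarrow> 'a set set" where
  "block V J a = {y \<in> Pow V. y \<inter> J = a}"

text \<open>\<open>junta_error V J F\<close> is the least number of points in which \<open>F\<close> differs from a function that only
  depends on the coordinates in \<open>J\<close>.\<close>

definition junta_error :: "'a set \<Rightarrow> 'a set \<Rightarrow> 'a set set \<Rightarrow> real" where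
  "junta_error V J F = (\<Sum>a\<in>Pow J. minority (2 ^ card (V - J)) (card (F \<inter> block V J a)))"

lemma card_block:
  assumes "finite V" "J \<subseteq> V" "a \<subseteq> J"
  shows "card (block V J a) = 2 ^ card (V - J)"
proof -
  have "bij_betw (\<lambda>r. a \<union> r) (Pow (V - J)) (block V J a)"
    by (rule bij_betw_byWitness[where f' = "\<lambda>y. y - J"]) (use assms in \<open>auto simp: block_def\<close>)
  then show ?thesis
    using assms(1) by (metis bij_betw_same_card card_Pow finite_Diff)
qed

lemma finite_block: "finite V \<Longrightarrow> finite (block V J a)"
  by (simp add: block_def)

lemma disjoint_blocks: "disjoint_family_on (block V J) I"
  by (auto simp: disjoint_family_on_def block_def)

lemma Union_blocks: "(\<Union>a\<in>Pow J. block V J a) = Pow V"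
  by (auto simp: block_def)

lemma sum_card_blocks:
  assumes "finite V" "J \<subseteq> V" "G \<subseteq> Pow V"
  shows "(\<Sum>a\<in>Pow J. card (G \<inter> block V J a)) = card G"
proof -
  have "G = (\<Union>a\<in>Pow J. G \<inter> block V J a)" using assms Union_blocks[of V J] by auto
  moreover have "card (\<Union>a\<in>Pow J. G \<inter> block V J a) = (\<Sum>a\<in>Pow J. card (G \<inter> block V J a))"
    using assms by (intro card_UN_disjoint)
      (auto simp: finite_subset[of J V] block_def)
  ultimately show ?thesis by simp
qed

lemma card_Pow_split:
  assumes "finite V" "J \<subseteq> V"
  shows "(2::real) ^ card V = 2 ^ card J * 2 ^ card (V - J)"
  using assms by (simp add: card_Diff_subset finite_subset card_mono flip: power_add)

lemma minority_bounds:
  assumes "finite V" "J \<subseteq> V" "a \<subseteq> J" "P \<subseteq> block V J a"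
  shows "0 \<le> minority (2 ^ card (V - J)) (card P) / 2 ^ card (V - J)
    \<and> minority (2 ^ card (V - J)) (card P) / 2 ^ card (V - J) \<le> 1"
proof -
  have "card P \<le> 2 ^ card (V - J)"
    using card_mono[OF finite_block assms(4)] card_block[of V J a] assms by simp
  then have "real (card P) \<le> real (2 ^ card (V - J))" by (simp only: of_nat_le_iff)
  then show ?thesis by (simp add: minority_def)
qed

lemma blockwise_Pow:
  assumes "G \<subseteq> Pow V"
  shows "blockwise (Pow J) (block V J) (\<lambda>a. Pow (G \<inter> block V J a)) = Pow G"
proof (intro set_eqI iffI)
  fix F assume F: "F \<in> blockwise (Pow J) (block V J) (\<lambda>a. Pow (G \<inter> block V J a))"
  show "F \<in> Pow G"
  proof (intro PowI subsetI)
    fix x assume x: "x \<in> F"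
    then have "x \<in> block V J (x \<inter> J)"
      using F unfolding blockwise_def Union_blocks by (auto simp: block_def)
    moreover have "F \<inter> block V J (x \<inter> J) \<subseteq> G"
      using F by (auto simp: blockwise_def)
    ultimately show "x \<in> G" using x by blast
  qed
qed (use assms in \<open>auto simp: blockwise_def Union_blocks\<close>)

text \<open>A lower tail, obtained by applying the Chernoff bound to one minus the error rate of
  each block. The junta may read any coordinates, so \<open>G\<close> may fill blocks only
  partly.\<close>

lemma junta_error_uniform_tail:
  assumes V: "finite V" "J \<subseteq> V" and G: "G \<subseteq> Pow V" and s: "0 \<le> s" "s \<le> 1"
  shows "real (card {F \<in> Pow G. junta_error V J F
      \<le> card G * minority_rate (card (V - J)) - s * 2 ^ card V})
    \<le> exp (- s\<^sup>2 * 2 ^ card J / 4) * 2 ^ card G"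
proof -
  define l where "l = card (V - J)"
  let ?B = "block V J" and ?P = "\<lambda>a. Pow (G \<inter> block V J a)"
  let ?X = "\<lambda>(a::'a set) P. 1 - minority (2 ^ l) (card P) / 2 ^ l"
  let ?m = "2 ^ card J - card G * minority_rate l / 2 ^ l"
  have finJ: "finite J" using V finite_subset by blast
  have finG: "finite G" using G V finite_subset by blast
  have mean: "(\<Sum>P\<in>?P a. ?X a P) / card (?P a) \<le> 1 - card (G \<inter> ?B a) * minority_rate l / 2 ^ l"
    if "a \<in> Pow J" for a
  proof -
    let ?g = "card (G \<inter> ?B a)"
    have fin: "finite (G \<inter> ?B a)" using finG by simp
    have "?g \<le> card (?B a)" by (rule card_mono) (use V finite_block in auto)
    then have "?g \<le> 2 ^ l" using card_block[of V J a] V that by (simp add: l_def)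
    \<comment> \<open>Concavity enters here: a partly filled block has at least its proportional
      share of the mean error of a full block.\<close>
    then have "real ?g * bin_avg (minority (2 ^ l)) (2 ^ l) 0
        \<le> 2 ^ l * bin_avg (minority (2 ^ l)) ?g 0"
      using minority_partial_fill[of ?g "2 ^ l"] by simp
    then have *: "?g * minority_rate l \<le> bin_avg (minority (2 ^ l)) ?g 0"
      by (simp add: minority_rate_def field_simps)
    have "(\<Sum>P\<in>?P a. ?X a P) = 2 ^ ?g - (2 ^ ?g * bin_avg (minority (2 ^ l)) ?g 0) / 2 ^ l"
      using sum_Pow_eq_bin_avg[OF fin, of "minority (2 ^ l)" 0] fin
      by (simp add: sum_subtractf card_Pow del: Pow_Int_eq flip: sum_divide_distrib)
    also have "\<dots> / card (?P a) = 1 - bin_avg (minority (2 ^ l)) ?g 0 / 2 ^ l"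
      using fin by (simp add: card_Pow diff_divide_distrib del: Pow_Int_eq)
    also have "\<dots> \<le> 1 - ?g * minority_rate l / 2 ^ l"
      using * by (intro diff_left_mono divide_right_mono) auto
    finally show ?thesis .
  qed
  have "(\<Sum>a\<in>Pow J. (\<Sum>P\<in>?P a. ?X a P) / card (?P a))
      \<le> (\<Sum>a\<in>Pow J. 1 - card (G \<inter> ?B a) * (minority_rate l / 2 ^ l))"
    by (rule sum_mono) (use mean in simp)
  also have "\<dots> = 2 ^ card J - (\<Sum>a\<in>Pow J. real (card (G \<inter> ?B a))) * (minority_rate l / 2 ^ l)"
    using finJ by (simp only: sum_subtractf sum_distrib_right) (simp add: card_Pow)
  also have "(\<Sum>a\<in>Pow J. real (card (G \<inter> ?B a))) = card G"
    using arg_cong[OF sum_card_blocks[OF V G], of real] by simp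
  finally have m: "(\<Sum>a\<in>Pow J. (\<Sum>P\<in>?P a. ?X a P) / card (?P a)) \<le> ?m" by simp
  have "real (card {F \<in> blockwise (Pow J) ?B ?P.
        ?m + s * card (Pow J) \<le> (\<Sum>a\<in>Pow J. ?X a (F \<inter> ?B a))})
      \<le> exp (- s\<^sup>2 * card (Pow J) / 4) * card (blockwise (Pow J) ?B ?P)"
  proof (rule blockwise_chernoff[OF _ disjoint_blocks _ _ _ _ m s])
    fix a P assume "a \<in> Pow J" "P \<in> ?P a"
    then show "0 \<le> ?X a P \<and> ?X a P \<le> 1"
      using minority_bounds[of V J a P] V by (auto simp: l_def)
  qed (use finJ V finite_block in auto)
  moreover have "junta_error V J F \<le> card G * minority_rate l - s * 2 ^ card V
      \<longleftrightarrow> ?m + s * card (Pow J) \<le> (\<Sum>a\<in>Pow J. ?X a (F \<inter> ?B a))" for F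
  proof -
    have "(\<Sum>a\<in>Pow J. ?X a (F \<inter> ?B a)) = 2 ^ card J - junta_error V J F / 2 ^ l"
      using finJ by (simp add: junta_error_def l_def sum_subtractf card_Pow flip: sum_divide_distrib)
    moreover have "junta_error V J F \<le> card G * minority_rate l - s * 2 ^ card V
      \<longleftrightarrow> junta_error V J F / 2 ^ l \<le> (card G * minority_rate l - s * 2 ^ card V) / 2 ^ l"
      by (simp add: divide_le_cancel)
    ultimately show ?thesis
      using finJ by (simp add: card_Pow card_Pow_split[OF V] diff_divide_distrib flip: l_def) linarith
  qed
  ultimately show ?thesis
    using finJ finG by (simp add: blockwise_Pow[OF G] card_Pow l_def del: Pow_Int_eq)
qed

section \<open>Errors on flip-invariant functions\<close>

text \<open>\<open>C\<close> contains one point of each pair, so an invariant set is determined by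
  its trace on \<open>C\<close> and has twice the size of that trace.\<close>

lemma sum_flip_invariant:
  fixes h :: "nat \<Rightarrow> real"
  assumes fin: "finite B" and dec: "B = C \<union> flip R ` C" "C \<inter> flip R ` C = {}"
  shows "(\<Sum>F\<in>flip_invariant B R. h (card F)) = (\<Sum>P\<in>Pow C. h (2 * card P))"
proof (rule sum.reindex_bij_witness[of _ "\<lambda>P. P \<union> flip R ` P" "\<lambda>F. F \<inter> C"])
  have inj: "inj_on (flip R) S" for S by (metis flip_flip inj_onI)
  fix F assume F: "F \<in> flip_invariant B R"
  show dec_F: "F \<inter> C \<union> flip R ` (F \<inter> C) = F"
  proof
    show "F \<inter> C \<union> flip R ` (F \<inter> C) \<subseteq> F" using F by (auto simp: flip_invariant_def)
    show "F \<subseteq> F \<inter> C \<union> flip R ` (F \<inter> C)"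
    proof
      fix x assume x: "x \<in> F"
      then have "x \<in> C \<union> flip R ` C" using F dec by (auto simp: flip_invariant_def)
      then show "x \<in> F \<inter> C \<union> flip R ` (F \<inter> C)"
      proof
        assume "x \<in> flip R ` C"
        then obtain c where c: "c \<in> C" "x = flip R c" by blast
        then have "c \<in> F" using flip_invariant_iff[OF F] x by simp
        then show ?thesis using c by blast
      qed (use x in blast)
    qed
  qed
  show "F \<inter> C \<in> Pow C" by simp
  have "finite F" using F fin by (auto simp: flip_invariant_def finite_subset)
  then have "card (F \<inter> C \<union> flip R ` (F \<inter> C)) = card (F \<inter> C) + card (flip R ` (F \<inter> C))"
    using dec(2) by (intro card_Un_disjoint) auto
  then show "h (2 * card (F \<inter> C)) = h (card F)"
    unfolding dec_F by (simp add: card_image[OF inj] mult_2)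
next
  fix P assume P: "P \<in> Pow C"
  have "x \<notin> C" if "x \<in> flip R ` P" for x using that P dec(2) by blast
  then show "(P \<union> flip R ` P) \<inter> C = P" using P by blast
  have "P \<union> flip R ` P \<subseteq> B" using P dec(1) by blast
  then show "P \<union> flip R ` P \<in> flip_invariant B R"
    by (auto simp: flip_invariant_def)
qed

lemma minority_double: "minority (2 * m) (2 * w) = 2 * minority m w"
  by (simp add: minority_def min_def)

lemma flip_in_block: "R \<subseteq> V \<Longrightarrow> flip R x \<in> block V (V - R) a \<longleftrightarrow> x \<in> block V (V - R) a"
proof -
  assume R: "R \<subseteq> V"
  have "flip R x \<inter> (V - R) = x \<inter> (V - R)" by (auto simp: flip_def)
  moreover have "flip R x \<subseteq> V \<longleftrightarrow> x \<subseteq> V" using R by (auto simp: flip_def)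
  ultimately show ?thesis by (simp add: block_def)
qed

text \<open>Fixing one coordinate \<open>r\<close> of \<open>R\<close> selects a point from each
  pair, leaving \<open>2 ^ l\<close> fair coins that count twice. Hence the rate belongs to
  \<open>l\<close>, although the block has dimension \<open>Suc l\<close>.\<close>

lemma flip_invariant_block_mean:
  assumes V: "finite V" "R \<subseteq> V" "card R = Suc l" "a \<subseteq> V - R"
  shows "(\<Sum>F\<in>flip_invariant (block V (V - R) a) R. minority (2 ^ Suc l) (card F))
    / card (flip_invariant (block V (V - R) a) R) = 2 ^ Suc l * minority_rate l"
proof -
  let ?B = "block V (V - R) a"
  from V(3) obtain r where r: "r \<in> R" by fastforce
  define C where "C = {y \<in> ?B. r \<notin> y}"
  have finB: "finite ?B" by (rule finite_block[OF V(1)])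
  have mem_flip: "r \<in> flip R x \<longleftrightarrow> r \<notin> x" for x using r by (auto simp: flip_def)
  have img: "flip R ` C = {y \<in> ?B. r \<in> y}"
  proof
    show "flip R ` C \<subseteq> {y \<in> ?B. r \<in> y}"
      using flip_in_block[OF V(2)] mem_flip by (auto simp: C_def)
    show "{y \<in> ?B. r \<in> y} \<subseteq> flip R ` C"
    proof
      fix y assume "y \<in> {y \<in> ?B. r \<in> y}"
      then have "flip R y \<in> C" using flip_in_block[OF V(2)] mem_flip by (auto simp: C_def)
      then show "y \<in> flip R ` C" by (metis flip_flip image_eqI)
    qed
  qed
  have dec: "?B = C \<union> flip R ` C" "C \<inter> flip R ` C = {}"
    unfolding img by (auto simp: C_def)
  have finC: "finite C" using finB by (simp add: C_def)
  have "card ?B = 2 ^ card (V - (V - R))"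
    by (rule card_block) (use V in auto)
  also have "V - (V - R) = R" using V(2) by auto
  finally have "card ?B = 2 ^ Suc l" using V(3) by simp
  moreover have "card ?B = card C + card (flip R ` C)"
    by (subst dec(1), rule card_Un_disjoint) (use finC dec(2) in auto)
  moreover have "card (flip R ` C) = card C" by (rule card_image) (metis flip_flip inj_onI)
  ultimately have cC: "card C = 2 ^ l" by simp
  have "(\<Sum>F\<in>flip_invariant ?B R. minority (2 ^ Suc l) (card F))
      = (\<Sum>P\<in>Pow C. 2 * minority (2 ^ l) (card P))"
    using sum_flip_invariant[OF finB dec, of "minority (2 ^ Suc l)"] by (simp add: minority_double)
  also have "\<dots> = 2 * (2 ^ (2 ^ l) * bin_avg (minority (2 ^ l)) (2 ^ l) 0)"
    using sum_Pow_eq_bin_avg[OF finC, of "minority (2 ^ l)" 0] cC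
    by (simp flip: sum_distrib_left)
  finally have num: "(\<Sum>F\<in>flip_invariant ?B R. minority (2 ^ Suc l) (card F))
      = 2 * (2 ^ (2 ^ l) * bin_avg (minority (2 ^ l)) (2 ^ l) 0)" .
  have "real (card (flip_invariant ?B R)) = 2 ^ (2 ^ l)"
    using sum_flip_invariant[OF finB dec, of "\<lambda>_. 1"] finC cC by (simp add: card_Pow)
  then show ?thesis unfolding num by (simp add: minority_rate_def)
qed

text \<open>Flipping \<open>R\<close> never leaves a block of \<open>V - R\<close>, so invariance
  can be imposed block by block.\<close>

lemma blockwise_flip_invariant:
  assumes "R \<subseteq> V" "G \<subseteq> Pow V"
  shows "blockwise (Pow (V - R)) (block V (V - R)) (\<lambda>a. flip_invariant (G \<inter> block V (V - R) a) R)
    = flip_invariant G R"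
proof (intro set_eqI iffI)
  fix F assume F: "F \<in> blockwise (Pow (V - R)) (block V (V - R))
    (\<lambda>a. flip_invariant (G \<inter> block V (V - R) a) R)"
  have "x \<in> G \<and> flip R x \<in> F" if x: "x \<in> F" for x
  proof -
    have "x \<in> Pow V" using F x unfolding blockwise_def Union_blocks by auto
    then have "x \<inter> (V - R) \<in> Pow (V - R)" "x \<in> block V (V - R) (x \<inter> (V - R))"
      by (auto simp: block_def)
    then have "F \<inter> block V (V - R) (x \<inter> (V - R))
        \<in> flip_invariant (G \<inter> block V (V - R) (x \<inter> (V - R))) R"
      "x \<in> F \<inter> block V (V - R) (x \<inter> (V - R))"
      using F x unfolding blockwise_def by auto
    then show ?thesis unfolding flip_invariant_def by blast
  qed
  then show "F \<in> flip_invariant G R" by (auto simp: flip_invariant_def)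
next
  fix F assume "F \<in> flip_invariant G R"
  then show "F \<in> blockwise (Pow (V - R)) (block V (V - R))
    (\<lambda>a. flip_invariant (G \<inter> block V (V - R) a) R)"
    using assms flip_in_block[OF assms(1)]
    unfolding blockwise_def Union_blocks flip_invariant_def by auto
qed

text \<open>By \<open>full\<close> every block lies inside or outside \<open>G\<close>, so the mean
  errors add up exactly to the share of \<open>G\<close>, and the Chernoff bound controls the upper
  tail.\<close>

lemma junta_error_invariant_tail:
  assumes V: "finite V" "R \<subseteq> V" "card R = Suc l" and G: "G \<subseteq> Pow V"
    and full: "\<And>a. a \<subseteq> V - R \<Longrightarrow> G \<inter> block V (V - R) a \<in> {{}, block V (V - R) a}"
    and s: "0 \<le> s" "s \<le> 1"
  shows "real (card {F \<in> flip_invariant G R.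
      card G * minority_rate l + s * 2 ^ card V \<le> junta_error V (V - R) F})
    \<le> exp (- s\<^sup>2 * 2 ^ card (V - R) / 4) * card (flip_invariant G R)"
proof -
  define J where "J = V - R"
  let ?B = "block V J" and ?P = "\<lambda>a. flip_invariant (G \<inter> block V J a) R"
  let ?X = "\<lambda>(a::'a set) F. minority (2 ^ Suc l) (card F) / 2 ^ Suc l"
  let ?m = "card G * minority_rate l / 2 ^ Suc l"
  have VJ: "V - J = R" "J \<subseteq> V" using V(2) by (auto simp: J_def)
  have finJ: "finite J" using V finite_subset VJ by blast
  have mean: "(\<Sum>F\<in>?P a. ?X a F) / card (?P a) = card (G \<inter> ?B a) * (minority_rate l / 2 ^ Suc l)"
    if "a \<in> Pow J" for a
  proof (cases "G \<inter> ?B a = {}")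
    case True
    have "flip_invariant {} R = {{}}" by (auto simp: flip_invariant_def)
    then show ?thesis using True by (simp add: minority_def)
  next
    case False
    then have eq: "G \<inter> ?B a = ?B a" using full[of a] that by (auto simp: J_def)
    have c: "card (?B a) = 2 ^ Suc l" using card_block[of V J a] V VJ that by simp
    have "(\<Sum>F\<in>?P a. ?X a F) / card (?P a)
      = (\<Sum>F\<in>?P a. minority (2 ^ Suc l) (card F)) / card (?P a) / 2 ^ Suc l"
      by (simp flip: sum_divide_distrib)
    also have "\<dots> = 2 ^ Suc l * minority_rate l / 2 ^ Suc l"
      unfolding eq using flip_invariant_block_mean[OF V, of a] that by (simp only: J_def Pow_iff)
    also have "\<dots> = card (?B a) * (minority_rate l / 2 ^ Suc l)" unfolding c by simp
    finally show ?thesis unfolding eq .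
  qed
  have "(\<Sum>a\<in>Pow J. (\<Sum>F\<in>?P a. ?X a F) / card (?P a))
      = (\<Sum>a\<in>Pow J. real (card (G \<inter> ?B a))) * (minority_rate l / 2 ^ Suc l)"
    by (simp only: mean sum_distrib_right cong: sum.cong)
  also have "(\<Sum>a\<in>Pow J. real (card (G \<inter> ?B a))) = card G"
    using arg_cong[OF sum_card_blocks[OF V(1) VJ(2) G], of real] by simp
  finally have m: "(\<Sum>a\<in>Pow J. (\<Sum>F\<in>?P a. ?X a F) / card (?P a)) \<le> ?m" by simp
  have "real (card {F \<in> blockwise (Pow J) ?B ?P.
        ?m + s * card (Pow J) \<le> (\<Sum>a\<in>Pow J. ?X a (F \<inter> ?B a))})
      \<le> exp (- s\<^sup>2 * card (Pow J) / 4) * card (blockwise (Pow J) ?B ?P)"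
  proof (rule blockwise_chernoff[OF _ disjoint_blocks _ _ _ _ m s])
    fix a P assume "a \<in> Pow J" "P \<in> ?P a"
    then have "a \<subseteq> J" "P \<subseteq> block V J a" by (auto simp: flip_invariant_def)
    from minority_bounds[OF V(1) VJ(2) this]
    show "0 \<le> ?X a P \<and> ?X a P \<le> 1" by (simp only: VJ V(3))
  next
    fix a show "?P a \<noteq> {}" by (auto simp: flip_invariant_def)
  qed (use finJ V finite_block in \<open>auto simp: flip_invariant_def\<close>)
  moreover have "card G * minority_rate l + s * 2 ^ card V \<le> junta_error V J F
      \<longleftrightarrow> ?m + s * card (Pow J) \<le> (\<Sum>a\<in>Pow J. ?X a (F \<inter> ?B a))" for F
  proof -
    have "(\<Sum>a\<in>Pow J. ?X a (F \<inter> ?B a)) = junta_error V J F / 2 ^ Suc l"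
      by (simp only: junta_error_def VJ V(3) sum_divide_distrib)
    moreover have "card G * minority_rate l + s * 2 ^ card V \<le> junta_error V J F
      \<longleftrightarrow> (card G * minority_rate l + s * 2 ^ card V) / 2 ^ Suc l \<le> junta_error V J F / 2 ^ Suc l"
      by (simp add: divide_le_cancel)
    moreover have "(card G * minority_rate l + s * 2 ^ card V) / 2 ^ Suc l = ?m + s * card (Pow J)"
      using finJ by (simp add: card_Pow card_Pow_split[OF V(1) VJ(2)] VJ(1) V(3) add_divide_distrib)
    ultimately show ?thesis by simp
  qed
  moreover have "blockwise (Pow J) ?B ?P = flip_invariant G R"
    using blockwise_flip_invariant[OF V(2) G] by (simp add: J_def)
  ultimately show ?thesis
    using finJ by (simp add: card_Pow flip: J_def)
qed

section \<open>Boolean functions on bit lists\<close>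

definition point :: "nat \<Rightarrow> bool list \<Rightarrow> nat set" where
  "point n x = {i. i < n \<and> x ! i}"

definition point_list :: "nat \<Rightarrow> nat set \<Rightarrow> bool list" where
  "point_list n y = map (\<lambda>i. i \<in> y) [0..<n]"

lemma point_list_in_cube: "point_list n y \<in> cube n"
  by (simp add: point_list_def cube_def)

lemma point_point_list: "y \<subseteq> {..<n} \<Longrightarrow> point n (point_list n y) = y"
  by (auto simp: point_def point_list_def)

lemma point_list_point: "x \<in> cube n \<Longrightarrow> point_list n (point n x) = x"
  by (auto simp: point_def point_list_def cube_def intro: nth_equalityI)

lemma bij_betw_point: "bij_betw (point n) (cube n) (Pow {..<n})"
  by (rule bij_betw_byWitness[where f' = "point_list n"])
     (auto simp: point_list_point point_point_list point_list_in_cube, auto simp: point_def)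

lemma finite_cube: "finite (cube n)"
  using bij_betw_finite[OF bij_betw_point] by simp

lemma card_cube: "card (cube n) = 2 ^ n"
  using bij_betw_same_card[OF bij_betw_point] by (simp add: card_Pow)

lemma fdist_eq: "fdist n f g = card {x \<in> cube n. f x \<noteq> g x} / 2 ^ n"
proof -
  have "cube n \<noteq> {}" using point_list_in_cube by blast
  then have "fdist n f g = card (cube n \<inter> {x. f x \<noteq> g x}) / card (cube n)"
    unfolding fdist_def using finite_cube by (rule measure_pmf_of_set)
  also have "cube n \<inter> {x. f x \<noteq> g x} = {x \<in> cube n. f x \<noteq> g x}" by auto
  finally show ?thesis by (simp add: card_cube)
qed

lemma card_disagree_blocks:
  assumes "J \<subseteq> {..<n}"
  shows "card {x \<in> cube n. (point n x \<in> F) \<noteq> g (point n x)}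
    = (\<Sum>a\<in>Pow J. card {y \<in> block {..<n} J a. (y \<in> F) \<noteq> g y})"
proof -
  let ?D = "{y \<in> Pow {..<n}. (y \<in> F) \<noteq> g y}"
  have "bij_betw (point n) {x \<in> cube n. (point n x \<in> F) \<noteq> g (point n x)} ?D"
    by (rule bij_betw_byWitness[where f' = "point_list n"])
       (auto simp: point_list_point point_point_list point_list_in_cube, auto simp: point_def)
  then have "card {x \<in> cube n. (point n x \<in> F) \<noteq> g (point n x)} = card ?D"
    by (rule bij_betw_same_card)
  also have "\<dots> = (\<Sum>a\<in>Pow J. card (?D \<inter> block {..<n} J a))"
    by (rule sum_card_blocks[symmetric]) (use assms in auto)
  also have "\<dots> = (\<Sum>a\<in>Pow J. card {y \<in> block {..<n} J a. (y \<in> F) \<noteq> g y})"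
    by (intro sum.cong refl arg_cong[where f = card]) (auto simp: block_def)
  finally show ?thesis .
qed

lemma card_disagree_const:
  assumes "finite B"
  shows "card {y \<in> B. (y \<in> F) \<noteq> c} = (if c then card B - card (F \<inter> B) else card (F \<inter> B))"
proof (cases c)
  case True
  then have "{y \<in> B. (y \<in> F) \<noteq> c} = B - F \<inter> B" by auto
  then show ?thesis using True assms by (simp add: card_Diff_subset)
next
  case False
  then have "{y \<in> B. (y \<in> F) \<noteq> c} = F \<inter> B" by auto
  then show ?thesis using False by simp
qed

text \<open>The coordinates outside \<open>J\<close> are switched one at a time, each without effect
  on \<open>g\<close>.\<close>

lemma not_depends_on_block_const:
  assumes "\<And>i. i < n \<Longrightarrow> depends_on n g i \<Longrightarrow> i \<in> J" and "y \<subseteq> {..<n}"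
  shows "g (point_list n y) = g (point_list n (y \<inter> J))"
proof -
  have "g (point_list n (a \<union> S)) = g (point_list n a)"
    if "finite S" "S \<subseteq> {..<n} - J" "a \<subseteq> J" for S a
    using that
  proof (induction S rule: finite_induct)
    case (insert i S)
    have i: "i < n" "i \<notin> a \<union> S" "\<not> depends_on n g i" using insert assms(1) by auto
    let ?x = "point_list n (a \<union> S)"
    have "point_list n (a \<union> insert i S) = ?x[i := \<not> ?x ! i]"
      using i by (auto simp: point_list_def nth_list_update intro!: nth_equalityI)
    then have "g (point_list n (a \<union> insert i S)) = g ?x"
      using i(3) point_list_in_cube unfolding depends_on_def by metis
    then show ?case using insert by simp
  qed simp
  from this[of "y - J" "y \<inter> J"] have "g (point_list n (y \<inter> J \<union> (y - J))) = g (point_list n (y \<inter> J))"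
    using assms(2) finite_subset[of y "{..<n}"] by auto
  moreover have "y \<inter> J \<union> (y - J) = y" by auto
  ultimately show ?thesis by simp
qed

text \<open>The relevant coordinates of a junta extend to a set of exactly \<open>k\<close>; on each
  block of that set the junta is constant and errs at least on the minority.\<close>

lemma far_from_juntasI:
  assumes "k \<le> n"
    and err: "\<And>J. J \<subseteq> {..<n} \<Longrightarrow> card J = k \<Longrightarrow> \<epsilon> * 2 ^ n \<le> junta_error {..<n} J F"
  shows "far_from_juntas n k \<epsilon> (\<lambda>x. point n x \<in> F)"
  unfolding far_from_juntas_def
proof (intro allI impI)
  fix g assume g: "junta n k g"
  let ?D = "{i. i < n \<and> depends_on n g i}"
  obtain J where J: "?D \<subseteq> J" "J \<subseteq> {..<n}" "card J = k"
    using exists_subset_between[of ?D k "{..<n}"] g assms(1) by (auto simp: junta_def)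
  let ?g = "\<lambda>y. g (point_list n y)"
  let ?M = "2 ^ card ({..<n} - J) :: nat"
  have "\<epsilon> * 2 ^ n \<le> junta_error {..<n} J F" by (rule err[OF J(2,3)])
  also have "\<dots> \<le> (\<Sum>a\<in>Pow J. real (card {y \<in> block {..<n} J a. (y \<in> F) \<noteq> ?g y}))"
    unfolding junta_error_def
  proof (rule sum_mono)
    fix a assume a: "a \<in> Pow J"
    let ?B = "block {..<n} J a"
    have cB: "card ?B = ?M" using card_block[of "{..<n}" J a] a J(2) by simp
    have "{y \<in> ?B. (y \<in> F) \<noteq> ?g y} = {y \<in> ?B. (y \<in> F) \<noteq> ?g a}"
      using not_depends_on_block_const[of n g J] J(1) by (auto simp: block_def)
    then have "card {y \<in> ?B. (y \<in> F) \<noteq> ?g y}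
        = (if ?g a then card ?B - card (F \<inter> ?B) else card (F \<inter> ?B))"
      by (simp only: card_disagree_const finite_block finite_lessThan)
    moreover have "card (F \<inter> ?B) \<le> card ?B" by (rule card_mono) (auto simp: finite_block)
    ultimately show "minority ?M (card (F \<inter> ?B)) \<le> card {y \<in> ?B. (y \<in> F) \<noteq> ?g y}"
      by (auto simp: minority_def of_nat_diff cB)
  qed
  also have "\<dots> = card {x \<in> cube n. (point n x \<in> F) \<noteq> ?g (point n x)}"
    using arg_cong[OF card_disagree_blocks[OF J(2), of F ?g], of real] by (simp only: of_nat_sum)
  also have "{x \<in> cube n. (point n x \<in> F) \<noteq> ?g (point n x)} = {x \<in> cube n. (point n x \<in> F) \<noteq> g x}"
    by (auto simp: point_list_point)
  finally show "\<epsilon> \<le> fdist n (\<lambda>x. point n x \<in> F) g"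
    by (simp add: fdist_eq field_simps)
qed

text \<open>The majority vote on each block, with ties decided as \<open>False\<close>, reads only
  \<open>J\<close> and errs exactly on the minority.\<close>

lemma close_to_juntaI:
  assumes J: "J \<subseteq> {..<n}" "card J \<le> k" and err: "junta_error {..<n} J F \<le> \<epsilon> * 2 ^ n"
  shows "close_to_junta n k \<epsilon> (\<lambda>x. point n x \<in> F)"
proof -
  let ?M = "2 ^ card ({..<n} - J) :: nat"
  define h where "h y \<longleftrightarrow> ?M < 2 * card (F \<inter> block {..<n} J (y \<inter> J))" for y
  let ?g = "\<lambda>x. h (point n x)"
  have "i \<in> J" if "i < n" "depends_on n ?g i" for i
  proof (rule ccontr)
    assume "i \<notin> J"
    then have "point n (x[i := \<not> x ! i]) \<inter> J = point n x \<inter> J" for x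
      by (auto simp: point_def) (metis nth_list_update_neq)+
    then have "?g (x[i := \<not> x ! i]) = ?g x" for x by (simp add: h_def)
    then show False using that(2) by (simp add: depends_on_def)
  qed
  then have "{i. i < n \<and> depends_on n ?g i} \<subseteq> J" by auto
  then have "card {i. i < n \<and> depends_on n ?g i} \<le> card J"
    using J(1) finite_subset by (intro card_mono) auto
  then have "junta n k ?g" using J(2) by (simp add: junta_def)
  moreover have "real (card {x \<in> cube n. (point n x \<in> F) \<noteq> ?g x}) = junta_error {..<n} J F"
    unfolding card_disagree_blocks[OF J(1)] junta_error_def of_nat_sum
  proof (rule sum.cong)
    fix a assume a: "a \<in> Pow J"
    let ?B = "block {..<n} J a"
    have cB: "card ?B = ?M" using card_block[of "{..<n}" J a] a J by simp
    have "h y \<longleftrightarrow> ?M < 2 * card (F \<inter> ?B)" if "y \<in> ?B" for y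
      using that by (simp add: h_def block_def)
    then have "{y \<in> ?B. (y \<in> F) \<noteq> h y} = {y \<in> ?B. (y \<in> F) \<noteq> (?M < 2 * card (F \<inter> ?B))}"
      by auto
    then have "card {y \<in> ?B. (y \<in> F) \<noteq> h y}
        = (if ?M < 2 * card (F \<inter> ?B) then card ?B - card (F \<inter> ?B) else card (F \<inter> ?B))"
      by (simp only: card_disagree_const finite_block finite_lessThan)
    moreover have "card (F \<inter> ?B) \<le> card ?B" by (rule card_mono) (auto simp: finite_block)
    moreover have "2 * card (F \<inter> ?B) \<le> ?M \<longleftrightarrow> 2 * real (card (F \<inter> ?B)) \<le> real ?M"
      by (metis of_nat_le_iff of_nat_mult of_nat_numeral)
    ultimately show "real (card {y \<in> ?B. (y \<in> F) \<noteq> h y}) = minority ?M (card (F \<inter> ?B))"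
      unfolding cB minority_def by (auto simp: of_nat_diff min_def)
  qed simp
  ultimately show ?thesis
    using err unfolding close_to_junta_def fdist_eq
    by (intro exI[of _ ?g]) (simp add: field_simps)
qed

text \<open>Negating a coordinate that \<open>g\<close> ignores exchanges agreement and disagreement
  with the parity.\<close>

lemma parity_far:
  assumes "junta n k g" "k < n"
  shows "fdist n (\<lambda>x. odd (card (point n x)) = b) g = 1 / 2"
proof -
  let ?f = "\<lambda>x. odd (card (point n x)) = b"
  let ?D = "{i. i < n \<and> depends_on n g i}"
  have "card ?D \<noteq> card {..<n}" using assms by (simp add: junta_def)
  then have "?D \<noteq> {..<n}" by metis
  then obtain i where i: "i < n" "\<not> depends_on n g i" by blast
  let ?s = "\<lambda>x. x[i := \<not> x ! i]"
  have s_cube: "?s x \<in> cube n" if "x \<in> cube n" for x using that by (simp add: cube_def)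
  have s_s: "?s (?s x) = x" if "x \<in> cube n" for x using that i by (simp add: cube_def)
  have g_s: "g (?s x) = g x" if "x \<in> cube n" for x using that i by (auto simp: depends_on_def)
  have f_s: "?f (?s x) \<longleftrightarrow> \<not> ?f x" if x: "x \<in> cube n" for x
  proof -
    have len: "length x = n" using x by (simp add: cube_def)
    have fin: "finite (point n x)" by (simp add: point_def)
    have "odd (card (point n (?s x))) \<longleftrightarrow> even (card (point n x))"
    proof (cases "x ! i")
      case True
      then have "point n (?s x) = point n x - {i}" "i \<in> point n x"
        using i len by (auto simp: point_def nth_list_update)
      then show ?thesis using card_Suc_Diff1[OF fin, of i] by (metis even_Suc)
    next
      case False
      then have "point n (?s x) = insert i (point n x)" "i \<notin> point n x"
        using i len by (auto simp: point_def nth_list_update)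
      then show ?thesis using fin by simp
    qed
    then show ?thesis by auto
  qed
  let ?N = "{x \<in> cube n. ?f x \<noteq> g x}" and ?E = "{x \<in> cube n. ?f x = g x}"
  have "bij_betw ?s ?N ?E"
  proof (rule bij_betw_byWitness[where f' = ?s])
    show "?s ` ?N \<subseteq> ?E" "?s ` ?E \<subseteq> ?N" using s_cube g_s f_s by blast+
  qed (use s_s in blast)+
  then have "card ?N = card ?E" by (rule bij_betw_same_card)
  moreover have "card ?N + card ?E = card (cube n)"
    using finite_cube by (subst card_Un_disjoint[symmetric]) (auto intro!: arg_cong[where f = card])
  ultimately have "2 * card ?N = 2 ^ n" by (simp add: card_cube)
  then have "real (2 * card ?N) = real (2 ^ n)" by (rule arg_cong)
  then show ?thesis unfolding fdist_eq by (simp add: field_simps)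
qed

section \<open>Indistinguishable distributions\<close>

lemma integrable_pmf_bounded:
  fixes f :: "'a \<Rightarrow> real"
  assumes "\<And>x. \<bar>f x\<bar> \<le> b"
  shows "integrable (measure_pmf M) f"
  by (rule measure_pmf.integrable_const_bound[where B = b]) (use assms in auto)

lemma integral_card_eq_sum_prob:
  assumes "finite S"
  shows "measure_pmf.expectation M (\<lambda>A. real (card {F \<in> S. Q A F}))
    = (\<Sum>F\<in>S. measure_pmf.prob M {A. Q A F})"
proof -
  have "measure_pmf.expectation M (\<lambda>A. real (card {F \<in> S. Q A F}))
      = measure_pmf.expectation M (\<lambda>A. \<Sum>F\<in>S. indicator {A. Q A F} A)"
    by (rule Bochner_Integration.integral_cong[OF refl])
       (use assms in \<open>simp add: indicator_def sum.If_cases Int_def\<close>)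
  also have "\<dots> = (\<Sum>F\<in>S. measure_pmf.expectation M (indicator {A. Q A F}))"
    by (intro Bochner_Integration.integral_sum integrable_pmf_bounded[where b = 1])
       (simp add: indicator_def)
  finally show ?thesis by simp
qed

lemma prob_not_accepts:
  "measure_pmf.prob M {A. \<not> accepts A f} = 1 - measure_pmf.prob M {A. accepts A f}"
proof -
  have "{A. \<not> accepts A f} = UNIV - {A. accepts A f}" by auto
  then show ?thesis using measure_pmf.prob_compl[of "{A. accepts A f}" M] by simp
qed

text \<open>For small \<open>k\<close> the claim reduces to \<open>q \<ge> 2\<close>: a single query cannot tell a random constant from
  a parity with a random sign.\<close>

lemma single_query_accepts:
  assumes "\<And>f. num_queries A f \<le> 1"
  shows "(of_bool (accepts A (\<lambda>_. True)) + of_bool (accepts A (\<lambda>_. False)) :: real)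
    = of_bool (accepts A (\<lambda>x. g x = True)) + of_bool (accepts A (\<lambda>x. g x = False))"
proof (cases A)
  case (Query x B)
  have "\<exists>c. B b = Output c" for b
    using assms[of "\<lambda>_. b"] unfolding Query by (cases "B b") auto
  then obtain c where c: "\<And>b. B b = Output (c b)" by metis
  \<comment> \<open>The two signs of \<open>g\<close> yield the answers \<open>True\<close> and
    \<open>False\<close> at \<open>x\<close> once each, just as the two constants do.\<close>
  show ?thesis unfolding Query by (cases "g x") (simp_all add: c)
qed simp

text \<open>With one query the two constants and the two signed parities have the same total
  acceptance probability, but it would have to be at least \<open>4 / 3\<close> for the former and
  at most \<open>2 / 3\<close> for the latter.\<close>

lemma tester_ge_two_queries:
  assumes T: "tolerant_junta_tester k \<epsilon>\<^sub>1 \<epsilon>\<^sub>2 T" and q: "makes_at_most_queries T q"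
    and "0 \<le> \<epsilon>\<^sub>1" "\<epsilon>\<^sub>2 \<le> 1 / 2"
  shows "2 \<le> q"
proof (rule ccontr)
  assume "\<not> 2 \<le> q"
  \<comment> \<open>The least number of variables for which the full parity is not a
    \<open>k\<close>-junta.\<close>
  define n where "n = Suc k"
  let ?p = "\<lambda>f. measure_pmf.prob (T n) {A. accepts A f}"
  let ?g = "\<lambda>x. odd (card (point n x))"
  have const: "?p (\<lambda>_. b) \<ge> 2 / 3" for b
  proof -
    have "fdist n (\<lambda>_. b) (\<lambda>_. b) = 0" by (simp add: fdist_eq)
    moreover have "junta n k (\<lambda>_. b)" by (simp add: junta_def depends_on_def)
    ultimately have "close_to_junta n k \<epsilon>\<^sub>1 (\<lambda>_. b)"
      unfolding close_to_junta_def using assms(3) by (intro exI[of _ "\<lambda>_. b"]) simp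
    then show ?thesis using T unfolding tolerant_junta_tester_def by blast
  qed
  have parity: "?p (\<lambda>x. ?g x = b) \<le> 1 / 3" for b
  proof -
    have "far_from_juntas n k \<epsilon>\<^sub>2 (\<lambda>x. ?g x = b)"
      unfolding far_from_juntas_def
    proof (intro allI impI)
      fix g assume "junta n k g"
      then have "fdist n (\<lambda>x. ?g x = b) g = 1 / 2" by (rule parity_far) (simp add: n_def)
      then show "\<epsilon>\<^sub>2 \<le> fdist n (\<lambda>x. ?g x = b) g" using assms(4) by linarith
    qed
    then have "measure_pmf.prob (T n) {A. \<not> accepts A (\<lambda>x. ?g x = b)} \<ge> 2 / 3"
      using T unfolding tolerant_junta_tester_def by blast
    then show ?thesis by (simp add: prob_not_accepts)
  qed
  have p_int: "?p f = measure_pmf.expectation (T n) (\<lambda>A. of_bool (accepts A f))" for f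
  proof -
    have "?p f = measure_pmf.expectation (T n) (indicator {A. accepts A f})" by simp
    also have "indicator {A. accepts A f} = (\<lambda>A. of_bool (accepts A f) :: real)"
      by (auto simp: indicator_def)
    finally show ?thesis .
  qed
  have int: "integrable (measure_pmf (T n)) (\<lambda>A. of_bool (accepts A f) :: real)" for f
    by (rule integrable_pmf_bounded[where b = 1]) simp
  have "?p (\<lambda>_. True) + ?p (\<lambda>_. False) = measure_pmf.expectation (T n)
      (\<lambda>A. of_bool (accepts A (\<lambda>_. True)) + of_bool (accepts A (\<lambda>_. False)))"
    unfolding p_int by (rule Bochner_Integration.integral_add[symmetric]) (rule int)+
  also have "\<dots> = measure_pmf.expectation (T n)
      (\<lambda>A. of_bool (accepts A (\<lambda>x. ?g x = True)) + of_bool (accepts A (\<lambda>x. ?g x = False)))"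
  proof (rule integral_cong_AE)
    have "num_queries A f \<le> 1" if "A \<in> set_pmf (T n)" for A f
    proof -
      have "num_queries A f \<le> q" using q that by (simp add: makes_at_most_queries_def)
      then show ?thesis using \<open>\<not> 2 \<le> q\<close> by simp
    qed
    then show "AE A in measure_pmf (T n).
      of_bool (accepts A (\<lambda>_. True)) + of_bool (accepts A (\<lambda>_. False))
      = (of_bool (accepts A (\<lambda>x. ?g x = True)) + of_bool (accepts A (\<lambda>x. ?g x = False)) :: real)"
      unfolding AE_measure_pmf_iff by (intro ballI single_query_accepts) auto
  qed simp_all
  also have "\<dots> = ?p (\<lambda>x. ?g x = True) + ?p (\<lambda>x. ?g x = False)"
    unfolding p_int by (rule Bochner_Integration.integral_add) (rule int)+
  finally show False
    using const[of True] const[of False] parity[of True] parity[of False] by linarith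
qed

section \<open>Hard instances on a region of prescribed density\<close>

text \<open>Flips of coordinates from \<open>t\<close> on preserve the region, and its density can
  be any multiple of \<open>1 / 2 ^ t\<close> up to 1.\<close>

definition prefix_region :: "nat \<Rightarrow> nat \<Rightarrow> nat set set \<Rightarrow> nat set set" where
  "prefix_region n t \<H> = {x \<in> Pow {..<n}. x \<inter> {..<t} \<in> \<H>}"

lemma prefix_region_block:
  assumes "R \<subseteq> {t..<n}" "a \<subseteq> {..<n} - R" "t \<le> n"
  shows "prefix_region n t \<H> \<inter> block {..<n} ({..<n} - R) a
    = (if a \<inter> {..<t} \<in> \<H> then block {..<n} ({..<n} - R) a else {})"
proof -
  have "x \<inter> {..<t} = a \<inter> {..<t}" if "x \<in> block {..<n} ({..<n} - R) a" for x
  proof -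
    have "x \<inter> {..<t} = (x \<inter> ({..<n} - R)) \<inter> {..<t}" using assms(1,3) by auto
    then show ?thesis using that by (simp add: block_def)
  qed
  moreover have "block {..<n} ({..<n} - R) a \<subseteq> Pow {..<n}" by (auto simp: block_def)
  ultimately show ?thesis by (auto simp: prefix_region_def)
qed

lemma card_prefix_region:
  assumes "t \<le> n" "\<H> \<subseteq> Pow {..<t}"
  shows "card (prefix_region n t \<H>) = card \<H> * 2 ^ (n - t)"
proof -
  have "prefix_region n t \<H> = (\<Union>a\<in>\<H>. block {..<n} {..<t} a)"
    by (auto simp: prefix_region_def block_def)
  also have "card \<dots> = (\<Sum>a\<in>\<H>. card (block {..<n} {..<t} a))"
    using assms finite_subset[OF assms(2)]
    by (intro card_UN_disjoint) (auto simp: block_def)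
  also have "\<dots> = (\<Sum>a\<in>\<H>. 2 ^ (n - t))"
  proof (rule sum.cong[OF refl])
    fix a assume "a \<in> \<H>"
    then have "card (block {..<n} {..<t} a) = 2 ^ card ({..<n} - {..<t})"
      using assms by (intro card_block) auto
    also have "card ({..<n} - {..<t}) = n - t"
      using assms by (subst card_Diff_subset) auto
    finally show "card (block {..<n} {..<t} a) = 2 ^ (n - t)" .
  qed
  finally show ?thesis by simp
qed

text \<open>A union bound over all \<open>k\<close>-sets of coordinates, of which there are at most
  \<open>2 ^ n\<close>; \<open>small\<close> absorbs this factor.\<close>

lemma most_uniform_far:
  assumes n: "n = k + l" and G: "G \<subseteq> Pow {..<n}" and s: "0 \<le> s" "s \<le> 1"
    and \<epsilon>: "(\<epsilon> + s) * 2 ^ n \<le> card G * minority_rate l"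
    and small: "exp (- s\<^sup>2 * 2 ^ k / 4) * 2 ^ n \<le> 1 / 10"
  shows "real (card {F \<in> Pow G. \<not> far_from_juntas n k \<epsilon> (\<lambda>x. point n x \<in> F)}) \<le> 2 ^ card G / 10"
proof -
  let ?\<J> = "{J \<in> Pow {..<n}. card J = k}"
  let ?bad = "\<lambda>J. {F \<in> Pow G. junta_error {..<n} J F \<le> card G * minority_rate l - s * 2 ^ n}"
  have finG: "finite G" using G finite_subset by blast
  have "card ({..<n} - J) = l" if "J \<in> ?\<J>" for J
    using that n finite_subset[of J "{..<n}"] by (auto simp: card_Diff_subset)
  then have bad: "real (card (?bad J)) \<le> exp (- s\<^sup>2 * 2 ^ k / 4) * 2 ^ card G" if "J \<in> ?\<J>" for J
    using junta_error_uniform_tail[OF _ _ G s, of J] that by simp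
  have "{F \<in> Pow G. \<not> far_from_juntas n k \<epsilon> (\<lambda>x. point n x \<in> F)} \<subseteq> (\<Union>J\<in>?\<J>. ?bad J)"
  proof
    fix F assume F: "F \<in> {F \<in> Pow G. \<not> far_from_juntas n k \<epsilon> (\<lambda>x. point n x \<in> F)}"
    have "\<exists>J. J \<subseteq> {..<n} \<and> card J = k \<and> junta_error {..<n} J F < \<epsilon> * 2 ^ n"
    proof (rule ccontr)
      assume no: "\<nexists>J. J \<subseteq> {..<n} \<and> card J = k \<and> junta_error {..<n} J F < \<epsilon> * 2 ^ n"
      have "far_from_juntas n k \<epsilon> (\<lambda>x. point n x \<in> F)"
      proof (rule far_from_juntasI)
        fix J assume "J \<subseteq> {..<n}" "card J = k"
        then have "\<not> junta_error {..<n} J F < \<epsilon> * 2 ^ n" using no by blast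
        then show "\<epsilon> * 2 ^ n \<le> junta_error {..<n} J F" by simp
      qed (simp add: n)
      then show False using F by simp
    qed
    then obtain J where J: "J \<subseteq> {..<n}" "card J = k" "junta_error {..<n} J F < \<epsilon> * 2 ^ n" by blast
    have "junta_error {..<n} J F \<le> card G * minority_rate l - s * 2 ^ n"
      using J(3) \<epsilon> unfolding distrib_right by linarith
    then show "F \<in> (\<Union>J\<in>?\<J>. ?bad J)" using F J by blast
  qed
  then have "card {F \<in> Pow G. \<not> far_from_juntas n k \<epsilon> (\<lambda>x. point n x \<in> F)} \<le> card (\<Union>J\<in>?\<J>. ?bad J)"
    using finG by (intro card_mono) auto
  also have "\<dots> \<le> (\<Sum>J\<in>?\<J>. card (?bad J))" by (rule card_UN_le) simp
  finally have "real (card {F \<in> Pow G. \<not> far_from_juntas n k \<epsilon> (\<lambda>x. point n x \<in> F)})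
      \<le> (\<Sum>J\<in>?\<J>. real (card (?bad J)))" by (simp only: of_nat_sum[symmetric] of_nat_le_iff)
  also have "\<dots> \<le> card ?\<J> * (exp (- s\<^sup>2 * 2 ^ k / 4) * 2 ^ card G)"
    by (rule sum_bounded_above) (rule bad)
  also have "\<dots> \<le> 2 ^ n * (exp (- s\<^sup>2 * 2 ^ k / 4) * 2 ^ card G)"
  proof (rule mult_right_mono)
    have "card ?\<J> \<le> card (Pow {..<n})" by (rule card_mono) auto
    then have "card ?\<J> \<le> 2 ^ n" by (simp add: card_Pow)
    then show "real (card ?\<J>) \<le> 2 ^ n" by (metis of_nat_le_iff of_nat_numeral of_nat_power)
  qed simp
  also have "\<dots> = (exp (- s\<^sup>2 * 2 ^ k / 4) * 2 ^ n) * 2 ^ card G" by simp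
  also have "\<dots> \<le> (1 / 10) * 2 ^ card G" by (rule mult_right_mono[OF small]) simp
  finally show ?thesis by simp
qed

text \<open>The complement of \<open>R\<close> has exactly \<open>k\<close> coordinates and is the
  only junta to examine, so no union bound is taken.\<close>

lemma most_invariant_close:
  assumes n: "n = k + Suc l" and t: "t \<le> n" and R: "R \<subseteq> {t..<n}" "card R = Suc l"
    and G: "G = prefix_region n t \<H>" and s: "0 \<le> s" "s \<le> 1"
    and \<epsilon>: "card G * minority_rate l \<le> (\<epsilon> - s) * 2 ^ n"
    and small: "exp (- s\<^sup>2 * 2 ^ k / 4) \<le> 1 / 10"
  shows "real (card {F \<in> flip_invariant G R. \<not> close_to_junta n k \<epsilon> (\<lambda>x. point n x \<in> F)})
    \<le> card (flip_invariant G R) / 10"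
proof -
  let ?J = "{..<n} - R"
  let ?bad = "{F \<in> flip_invariant G R.
    card G * minority_rate l + s * 2 ^ n \<le> junta_error {..<n} ?J F}"
  have Rn: "R \<subseteq> {..<n}" using R(1) by auto
  have GV: "G \<subseteq> Pow {..<n}" by (auto simp: G prefix_region_def)
  have finG: "finite G" using GV finite_subset by blast
  have cJ: "card ?J = k" using R(2) Rn n finite_subset[OF Rn] by (simp add: card_Diff_subset)
  have "real (card ?bad) \<le> exp (- s\<^sup>2 * 2 ^ card ?J / 4) * card (flip_invariant G R)"
    using junta_error_invariant_tail[OF _ Rn R(2) GV _ s] prefix_region_block[OF R(1) _ t]
    by (simp add: G)
  also have "\<dots> \<le> (1 / 10) * card (flip_invariant G R)"
    unfolding cJ by (rule mult_right_mono[OF small]) simp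
  finally have bad: "real (card ?bad) \<le> card (flip_invariant G R) / 10" by simp
  have "{F \<in> flip_invariant G R. \<not> close_to_junta n k \<epsilon> (\<lambda>x. point n x \<in> F)} \<subseteq> ?bad"
  proof
    fix F assume F: "F \<in> {F \<in> flip_invariant G R. \<not> close_to_junta n k \<epsilon> (\<lambda>x. point n x \<in> F)}"
    then have "\<not> junta_error {..<n} ?J F \<le> \<epsilon> * 2 ^ n"
      using close_to_juntaI[of ?J n k F \<epsilon>] cJ by blast
    then show "F \<in> ?bad" using F \<epsilon> unfolding left_diff_distrib by simp
  qed
  then have "card {F \<in> flip_invariant G R. \<not> close_to_junta n k \<epsilon> (\<lambda>x. point n x \<in> F)} \<le> card ?bad"
    using finite_flip_invariant[OF finG] by (intro card_mono) auto
  then show ?thesis using bad by linarith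
qed

text \<open>At least \<open>9 / 10\<close> of the inputs are far, each rejected with probability at
  least \<open>2 / 3\<close>.\<close>

lemma sum_prob_reject_lower:
  assumes T: "tolerant_junta_tester k \<epsilon>\<^sub>1 \<epsilon>\<^sub>2 T" and "finite S"
    and "real (card {F \<in> S. \<not> far_from_juntas n k \<epsilon>\<^sub>2 (f F)}) \<le> card S / 10"
  shows "card S * (3 / 5) \<le> (\<Sum>F\<in>S. measure_pmf.prob (T n) {A. \<not> accepts A (f F)})"
proof -
  let ?far = "{F \<in> S. far_from_juntas n k \<epsilon>\<^sub>2 (f F)}"
  have "card S = card ?far + card {F \<in> S. \<not> far_from_juntas n k \<epsilon>\<^sub>2 (f F)}"
    using assms(2) by (subst card_Un_disjoint[symmetric]) (auto intro!: arg_cong[where f = card])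
  then have "card S * (9 / 10) \<le> real (card ?far)" using assms(3) by simp
  then have "card S * (3 / 5) \<le> real (card ?far) * (2 / 3)" by linarith
  also have "\<dots> = (\<Sum>F\<in>?far. 2 / 3)" by simp
  also have "\<dots> \<le> (\<Sum>F\<in>?far. measure_pmf.prob (T n) {A. \<not> accepts A (f F)})"
    using T unfolding tolerant_junta_tester_def by (intro sum_mono) blast
  also have "\<dots> \<le> (\<Sum>F\<in>S. measure_pmf.prob (T n) {A. \<not> accepts A (f F)})"
    using assms(2) by (intro sum_mono2) auto
  finally show ?thesis .
qed

text \<open>Close inputs contribute at most \<open>1 / 3\<close> each, and the exceptional tenth at
  most 1 more: \<open>1 / 3 + 1 / 10 = 13 / 30\<close>.\<close>

lemma sum_prob_reject_upper:
  assumes T: "tolerant_junta_tester k \<epsilon>\<^sub>1 \<epsilon>\<^sub>2 T" and "finite S"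
    and "real (card {F \<in> S. \<not> close_to_junta n k \<epsilon>\<^sub>1 (f F)}) \<le> card S / 10"
  shows "(\<Sum>F\<in>S. measure_pmf.prob (T n) {A. \<not> accepts A (f F)}) \<le> card S * (13 / 30)"
proof -
  let ?p = "\<lambda>F. measure_pmf.prob (T n) {A. \<not> accepts A (f F)}"
  let ?c = "\<lambda>F. close_to_junta n k \<epsilon>\<^sub>1 (f F)"
  have "?p F \<le> 1 / 3 + (if \<not> ?c F then 1 else 0)" for F
  proof (cases "?c F")
    case True
    then have "measure_pmf.prob (T n) {A. accepts A (f F)} \<ge> 2 / 3"
      using T unfolding tolerant_junta_tester_def by blast
    then show ?thesis using True by (simp add: prob_not_accepts)
  next
    case False
    have "?p F \<le> 1" by (rule measure_pmf.prob_le_1)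
    then have "?p F \<le> 1 / 3 + 1" by linarith
    then show ?thesis using False by (simp only: if_True simp_thms)
  qed
  then have "(\<Sum>F\<in>S. ?p F) \<le> (\<Sum>F\<in>S. 1 / 3 + (if \<not> ?c F then 1 else 0))" by (rule sum_mono)
  also have "\<dots> = card S / 3 + card {F \<in> S. \<not> ?c F}"
    using assms(2) by (simp add: sum.distrib sum.If_cases Int_def)
  finally show ?thesis using assms(3) by simp
qed

text \<open>For each \<open>R\<close> the rejection probabilities on the two kinds of instances
  differ by at least \<open>3 / 5 - 13 / 30 = 1 / 6\<close>, whereas for each deterministic
  algorithm the differences sum to at most the square of \<open>q\<close> over all \<open>R\<close>.
  Exchanging sum and expectation compares the two.\<close>

lemma query_lower_bound:
  fixes h t k l q :: nat and s \<epsilon>\<^sub>1 \<epsilon>\<^sub>2 :: real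
  assumes T: "tolerant_junta_tester k \<epsilon>\<^sub>1 \<epsilon>\<^sub>2 T" and q: "makes_at_most_queries T q"
    and t: "t \<le> k" and h: "h \<le> 2 ^ t" and s: "0 \<le> s" "s \<le> 1"
    and far: "\<epsilon>\<^sub>2 + s \<le> h / 2 ^ t * minority_rate (Suc l)"
    and close: "h / 2 ^ t * minority_rate l \<le> \<epsilon>\<^sub>1 - s"
    and small: "exp (- s\<^sup>2 * 2 ^ k / 4) * 2 ^ (k + Suc l) \<le> 1 / 10"
  shows "real ((k + Suc l - t) choose Suc l) \<le> 6 * (real q)\<^sup>2"
proof -
  define n where "n = k + Suc l"
  obtain \<H> where \<H>: "\<H> \<subseteq> Pow {..<t}" "card \<H> = h"
    using obtain_subset_with_card_n[of h "Pow {..<t}"] h by (auto simp: card_Pow)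
  define G where "G = prefix_region n t \<H>"
  define \<R> where "\<R> = {R \<in> Pow {t..<n}. card R = Suc l}"
  let ?Y = "\<lambda>R. flip_invariant G R"
  let ?p = "\<lambda>F. measure_pmf.prob (T n) {A. \<not> accepts A (\<lambda>x. point n x \<in> F)}"
  let ?r = "\<lambda>\<F> A. card {F \<in> \<F>. \<not> accepts A (\<lambda>x. point n x \<in> F)}"
  have tn: "t \<le> n" using t by (simp add: n_def)
  have GV: "G \<subseteq> Pow {..<n}" by (auto simp: G_def prefix_region_def)
  have finG: "finite G" using GV finite_subset by blast
  have fin\<R>: "finite \<R>" by (simp add: \<R>_def)
  have card\<R>: "card \<R> = (n - t) choose Suc l"
    using n_subsets[of "{t..<n}" "Suc l"] by (simp add: \<R>_def)
  have "real (card G) = real h * 2 ^ (n - t)"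
    using card_prefix_region[OF tn \<H>(1)] \<H>(2) by (simp add: G_def)
  also have "(2::real) ^ (n - t) = 2 ^ n / 2 ^ t" using tn by (simp add: power_diff)
  finally have cG: "real (card G) = h / 2 ^ t * 2 ^ n" by simp
  have Ypos: "card (?Y R) > 0" for R
  proof -
    have "{} \<in> ?Y R" by (simp add: flip_invariant_def)
    then show ?thesis using finite_flip_invariant[OF finG] card_gt_0_iff by blast
  qed
  have no: "2 ^ card G * (3 / 5) \<le> (\<Sum>F\<in>Pow G. ?p F)"
  proof -
    have "(\<epsilon>\<^sub>2 + s) * 2 ^ n \<le> card G * minority_rate (Suc l)"
      using mult_right_mono[OF far, of "2 ^ n"] by (simp add: cG mult_ac)
    from most_uniform_far[OF n_def GV s this] small
    have "real (card {F \<in> Pow G. \<not> far_from_juntas n k \<epsilon>\<^sub>2 (\<lambda>x. point n x \<in> F)}) \<le> card (Pow G) / 10"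
      using finG by (simp add: n_def card_Pow)
    from sum_prob_reject_lower[OF T _ this] show ?thesis using finG by (simp add: card_Pow)
  qed
  have yes: "(\<Sum>F\<in>?Y R. ?p F) \<le> card (?Y R) * (13 / 30)" if "R \<in> \<R>" for R
  proof (rule sum_prob_reject_upper[OF T finite_flip_invariant[OF finG]])
    have "exp (- s\<^sup>2 * 2 ^ k / 4) * 1 \<le> exp (- s\<^sup>2 * 2 ^ k / 4) * 2 ^ (k + Suc l)"
      by (rule mult_left_mono[OF one_le_power]) auto
    then have sm: "exp (- s\<^sup>2 * 2 ^ k / 4) \<le> 1 / 10" using small by linarith
    have "card G * minority_rate l \<le> (\<epsilon>\<^sub>1 - s) * 2 ^ n"
      using mult_right_mono[OF close, of "2 ^ n"] by (simp add: cG mult_ac)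
    then show "real (card {F \<in> ?Y R. \<not> close_to_junta n k \<epsilon>\<^sub>1 (\<lambda>x. point n x \<in> F)}) \<le> card (?Y R) / 10"
      using that by (intro most_invariant_close[OF n_def tn _ _ G_def s _ sm]) (auto simp: \<R>_def)
  qed
  have int: "integrable (measure_pmf (T n)) (\<lambda>A. real (?r \<F> A))" if "finite \<F>" for \<F>
    by (rule integrable_pmf_bounded[where b = "card \<F>"])
       (use that in \<open>auto intro: card_mono\<close>)
  have "card \<R> * (1 / 6) = (\<Sum>R\<in>\<R>. 3 / 5 - 13 / 30 :: real)" by simp
  also have "\<dots> \<le> (\<Sum>R\<in>\<R>. (\<Sum>F\<in>Pow G. ?p F) / 2 ^ card G - (\<Sum>F\<in>?Y R. ?p F) / card (?Y R))"
  proof (intro sum_mono diff_mono)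
    show "3 / 5 \<le> (\<Sum>F\<in>Pow G. ?p F) / 2 ^ card G" using no by (simp add: field_simps)
    show "(\<Sum>F\<in>?Y R. ?p F) / card (?Y R) \<le> 13 / 30" if "R \<in> \<R>" for R
      using yes[OF that] Ypos[of R] by (simp add: field_simps)
  qed
  also have "\<dots> = (\<Sum>R\<in>\<R>. measure_pmf.expectation (T n)
      (\<lambda>A. ?r (Pow G) A / 2 ^ card G - ?r (?Y R) A / card (?Y R)))"
  proof (rule sum.cong[OF refl])
    fix R
    have i1: "integrable (measure_pmf (T n)) (\<lambda>A. ?r (Pow G) A / 2 ^ card G)"
      and i2: "integrable (measure_pmf (T n)) (\<lambda>A. ?r (?Y R) A / card (?Y R))"
      by (intro integrable_divide int finite_flip_invariant[OF finG]; simp add: finG)+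
    show "(\<Sum>F\<in>Pow G. ?p F) / 2 ^ card G - (\<Sum>F\<in>?Y R. ?p F) / card (?Y R)
      = measure_pmf.expectation (T n) (\<lambda>A. ?r (Pow G) A / 2 ^ card G - ?r (?Y R) A / card (?Y R))"
      unfolding Bochner_Integration.integral_diff[OF i1 i2] integral_divide_zero
      using finG finite_flip_invariant[OF finG] by (simp only: integral_card_eq_sum_prob finite_Pow_iff)
  qed
  also have "\<dots> = measure_pmf.expectation (T n)
      (\<lambda>A. \<Sum>R\<in>\<R>. ?r (Pow G) A / 2 ^ card G - ?r (?Y R) A / card (?Y R))"
    by (intro Bochner_Integration.integral_sum[symmetric] Bochner_Integration.integrable_diff
        integrable_divide int finite_flip_invariant[OF finG]; simp add: finG)
  also have "\<dots> \<le> measure_pmf.expectation (T n) (\<lambda>A. (real q)\<^sup>2)"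
  proof (rule integral_mono_AE)
    show "integrable (measure_pmf (T n))
      (\<lambda>A. \<Sum>R\<in>\<R>. ?r (Pow G) A / 2 ^ card G - ?r (?Y R) A / card (?Y R))"
      by (intro Bochner_Integration.integrable_sum Bochner_Integration.integrable_diff
          integrable_divide int finite_flip_invariant[OF finG]; simp add: finG)
    show "AE A in measure_pmf (T n).
      (\<Sum>R\<in>\<R>. ?r (Pow G) A / 2 ^ card G - ?r (?Y R) A / card (?Y R)) \<le> (real q)\<^sup>2"
      unfolding AE_measure_pmf_iff
    proof (intro ballI query_indistinguishable[OF finG fin\<R>])
      fix R x assume R: "R \<in> \<R>"
      show "R \<noteq> {}" using R by (auto simp: \<R>_def)
      assume x: "x \<in> G"
      have "flip R x \<inter> {..<t} = x \<inter> {..<t}" "flip R x \<subseteq> {..<n}"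
        using R x by (auto simp: \<R>_def flip_def G_def prefix_region_def)
      then show "flip R x \<in> G" using x by (simp add: G_def prefix_region_def)
    next
      fix A f assume "A \<in> set_pmf (T n)"
      then show "num_queries A f \<le> q" using q by (simp add: makes_at_most_queries_def)
    qed
  qed simp
  also have "\<dots> = (real q)\<^sup>2" by simp
  finally have "real (card \<R>) \<le> 6 * (real q)\<^sup>2" by linarith
  then show ?thesis unfolding card\<R> n_def .
qed

section \<open>Choice of the parameters\<close>

text \<open>\<open>X\<close> stands for \<open>C\<^sub>1 * k powr 0.99\<close>, and
  \<open>k1\<close> to \<open>k4\<close> express that \<open>k\<close> is large. The gap
  \<open>\<eta>\<close> also serves as the allowed deviation \<open>s\<close>.\<close>

lemma query_lower_bound_large_k:
  fixes k q :: nat and \<epsilon>\<^sub>1 \<epsilon>\<^sub>2 X \<delta> :: real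
  assumes T: "tolerant_junta_tester k \<epsilon>\<^sub>1 \<epsilon>\<^sub>2 T" and q: "makes_at_most_queries T q"
    and \<epsilon>: "0 < \<epsilon>\<^sub>1" "\<epsilon>\<^sub>1 < \<epsilon>\<^sub>2" "\<epsilon>\<^sub>2 \<le> 0.49"
    and gap: "2 powr (- X) \<le> \<epsilon>\<^sub>2 - \<epsilon>\<^sub>1" and \<delta>: "\<delta> = 1 - \<epsilon>\<^sub>1 / \<epsilon>\<^sub>2" "\<delta> \<le> 1 / 2 ^ 20"
    and k1: "4 * X + 4 \<le> k" and k2: "exp (- (2 powr (k / 2)) / 4) * 2 powr (2 * real k) \<le> 1 / 10"
    and k3: "k powr (1 / 200) * (2 * X) \<le> k" and k4: "6 \<le> k powr (1 / 400)"
  shows "k powr (- (1 / 1600 * log 2 \<delta>)) \<le> q"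
proof -
  define \<eta> where "\<eta> = \<epsilon>\<^sub>2 - \<epsilon>\<^sub>1"
  have \<eta>\<delta>: "\<eta> = \<epsilon>\<^sub>2 * \<delta>" using \<epsilon> by (simp add: \<eta>_def \<delta> field_simps)
  have \<eta>0: "0 < \<eta>" using \<epsilon> by (simp add: \<eta>_def)
  have \<delta>0: "0 < \<delta>" using \<epsilon> by (simp add: \<delta>)
  have "\<epsilon>\<^sub>2 * \<delta> \<le> 1 * \<delta>" using \<epsilon> \<delta>0 by (intro mult_right_mono) auto
  then have \<eta>le: "\<eta> \<le> \<delta>" by (simp add: \<eta>\<delta>)
  define L where "L = - log 2 \<delta>"
  have powr_L: "2 powr (- L) = \<delta>" using \<delta>0 by (simp add: L_def)
  have L20: "20 \<le> L"
  proof -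
    have "\<delta> \<le> 2 powr (- 20)" using \<delta>(2) by (simp add: powr_minus powr_realpow[symmetric] inverse_eq_divide)
    then show ?thesis unfolding powr_L[symmetric] by simp
  qed
  have LX: "L \<le> X"
  proof -
    have "2 powr (- X) \<le> 2 powr (- L)" using gap \<eta>le unfolding powr_L \<eta>_def by linarith
    then show ?thesis by simp
  qed
  \<comment> \<open>Subtracting 5 gives \<open>32 * \<delta> \<le> 1 / 2 ^ m\<close>, so the
    difference of the two minority rates is at least \<open>2 * \<delta>\<close>.\<close>
  define m where "m = nat \<lfloor>L - 5\<rfloor>"
  have m: "real m \<le> L - 5" "L - 6 \<le> real m" using L20 unfolding m_def by linarith+
  then have m14: "14 \<le> m" using L20 by linarith
  then obtain l where l: "m = Suc l" by (cases m) auto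
  \<comment> \<open>Large enough for the granularity \<open>1 / 2 ^ t\<close> of the density to be
    at most \<open>\<eta>\<close>.\<close>
  define t where "t = nat \<lceil>X\<rceil>"
  have t: "X \<le> real t" "real t \<le> X + 1" using L20 LX unfolding t_def by linarith+
  have pow_t: "1 / 2 ^ t \<le> \<eta>"
  proof -
    have "2 powr (- real t) \<le> 2 powr (- X)" using t by simp
    also have "\<dots> \<le> \<eta>" using gap by (simp add: \<eta>_def)
    finally show ?thesis by (simp add: powr_minus powr_realpow inverse_eq_divide)
  qed
  define r where "r = minority_rate m"
  have r: "0.495 \<le> r" "r \<le> 1 / 2"
    using minority_rate_ge[OF m14] minority_rate_le_half by (auto simp: r_def)
  have \<eta>small: "\<eta> \<le> 1 / 1000" using \<eta>le \<delta>(2) by simp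
  \<comment> \<open>The room between 0.49 and 0.495 keeps the required density at most 1.\<close>
  have num: "\<epsilon>\<^sub>2 + \<eta> \<le> r" using r \<epsilon> \<eta>small by simp
  \<comment> \<open>The least count that puts the mean error of the uniform instances at
    \<open>\<epsilon>\<^sub>2 + \<eta>\<close> or more; rounding up overshoots by at most
    \<open>\<eta>\<close>.\<close>
  define h where "h = nat \<lceil>2 ^ t * (\<epsilon>\<^sub>2 + \<eta>) / r\<rceil>"
  have h_nonneg: "0 \<le> 2 ^ t * (\<epsilon>\<^sub>2 + \<eta>) / r" using \<epsilon> \<eta>0 r by simp
  have h_lower: "2 ^ t * (\<epsilon>\<^sub>2 + \<eta>) / r \<le> h" and h_upper: "h \<le> 2 ^ t * (\<epsilon>\<^sub>2 + \<eta>) / r + 1"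
    using h_nonneg unfolding h_def by linarith+
  have h_le: "h \<le> 2 ^ t"
  proof -
    have "2 ^ t * (\<epsilon>\<^sub>2 + \<eta>) \<le> 2 ^ t * r" using num by simp
    then have "2 ^ t * (\<epsilon>\<^sub>2 + \<eta>) / r \<le> real_of_int (2 ^ t)" using r by (simp add: divide_le_eq)
    then have "\<lceil>2 ^ t * (\<epsilon>\<^sub>2 + \<eta>) / r\<rceil> \<le> 2 ^ t" by (rule ceiling_le)
    then show ?thesis unfolding h_def by (simp add: nat_le_iff)
  qed
  have far: "\<epsilon>\<^sub>2 + \<eta> \<le> h / 2 ^ t * r"
    using h_lower r by (simp add: field_simps)
  have hr: "h / 2 ^ t * r \<le> \<epsilon>\<^sub>2 + 2 * \<eta>"
  proof -
    have "h * r \<le> (2 ^ t * (\<epsilon>\<^sub>2 + \<eta>) / r + 1) * r" using h_upper r by (intro mult_right_mono) auto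
    also have "\<dots> = 2 ^ t * (\<epsilon>\<^sub>2 + \<eta>) + r" using r by (simp add: field_simps)
    also have "\<dots> \<le> 2 ^ t * (\<epsilon>\<^sub>2 + \<eta>) + 1" using r by simp
    finally have "h * r / 2 ^ t \<le> (2 ^ t * (\<epsilon>\<^sub>2 + \<eta>) + 1) / 2 ^ t" by (intro divide_right_mono) auto
    also have "\<dots> = \<epsilon>\<^sub>2 + \<eta> + 1 / 2 ^ t" by (simp add: add_divide_distrib)
    finally show ?thesis using pow_t by simp
  qed
  have close: "h / 2 ^ t * minority_rate l \<le> \<epsilon>\<^sub>1 - \<eta>"
  proof -
    have "2 ^ m = 2 powr real m" by (simp add: powr_realpow)
    also have "\<dots> \<le> 2 powr (L - 5)" using m(1) by simp
    also have "\<dots> = 1 / (32 * \<delta>)"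
      unfolding powr_L[symmetric] by (simp add: powr_diff powr_minus field_simps)
    finally have "32 * \<delta> \<le> 1 / 2 ^ m" using \<delta>0 by (simp add: field_simps)
    then have gap16: "2 * \<delta> \<le> 1 / (16 * 2 ^ m)" by (simp add: field_simps)
    have "minority_rate l \<le> r - 1 / (16 * 2 ^ m)" using minority_rate_gap[of l] by (simp add: r_def l)
    \<comment> \<open>As \<open>r \<le> 1 / 2\<close>, the rate drops by a relative
      \<open>4 * \<delta>\<close>. This lowers the mean error from at most
      \<open>\<epsilon>\<^sub>2 + 2 * \<eta>\<close> by at least \<open>4 * \<eta>\<close>, to at
      most \<open>\<epsilon>\<^sub>1 - \<eta>\<close>.\<close>
    also have "\<dots> \<le> r - 4 * \<delta> * r"
    proof -
      have "4 * \<delta> * r \<le> 4 * \<delta> * (1 / 2)" using r \<delta>0 by (intro mult_left_mono) auto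
      then show ?thesis using gap16 by simp
    qed
    finally have "h / 2 ^ t * minority_rate l \<le> h / 2 ^ t * (r - 4 * \<delta> * r)"
      by (intro mult_left_mono) auto
    also have "\<dots> = (h / 2 ^ t * r) * (1 - 4 * \<delta>)" by (simp add: field_simps)
    also have "\<dots> \<le> (\<epsilon>\<^sub>2 + 2 * \<eta>) * (1 - 4 * \<delta>)"
      using hr \<delta>(2) by (intro mult_right_mono) auto
    also have "\<dots> = \<epsilon>\<^sub>2 - 2 * \<eta> - 8 * \<eta> * \<delta>" by (simp add: \<eta>\<delta> algebra_simps)
    also have "\<dots> \<le> \<epsilon>\<^sub>2 - 2 * \<eta>" using \<eta>0 \<delta>0 by simp
    finally show ?thesis by (simp add: \<eta>_def)
  qed
  have small: "exp (- \<eta>\<^sup>2 * 2 ^ k / 4) * 2 ^ (k + Suc l) \<le> 1 / 10"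
  proof -
    \<comment> \<open>The squared gap costs at most \<open>2 * X\<close>, less than
      \<open>k / 2\<close>, in the exponent; the doubly exponential tail then beats the union
      bound.\<close>
    have "2 powr (k / 2) \<le> 2 powr (- X + - X + k)" using k1 L20 LX by simp
    also have "\<dots> = 2 powr (- X) * 2 powr (- X) * 2 ^ k"
      unfolding powr_add by (simp add: powr_realpow)
    also have "\<dots> \<le> \<eta> * \<eta> * 2 ^ k"
      using gap by (intro mult_right_mono mult_mono) (auto simp: \<eta>_def \<epsilon> less_imp_le)
    finally have "exp (- \<eta>\<^sup>2 * 2 ^ k / 4) \<le> exp (- (2 powr (k / 2)) / 4)"
      by (simp add: power2_eq_square)
    moreover have "2 ^ (k + Suc l) \<le> (2::real) powr (2 * real k)"
    proof -
      have "2 ^ (k + Suc l) = 2 powr real (k + m)" unfolding l by (rule powr_realpow[symmetric]) simp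
      also have "\<dots> \<le> 2 powr (2 * real k)" using m(1) LX k1 L20 by simp
      finally show ?thesis .
    qed
    ultimately have "exp (- \<eta>\<^sup>2 * 2 ^ k / 4) * 2 ^ (k + Suc l)
        \<le> exp (- (2 powr (k / 2)) / 4) * 2 powr (2 * real k)"
      by (intro mult_mono) auto
    then show ?thesis using k2 by linarith
  qed
  have tk: "t \<le> k" using t k1 L20 LX by linarith
  have main: "real ((k + m - t) choose m) \<le> 6 * (real q)\<^sup>2"
    using query_lower_bound[OF T q tk h_le _ _ _ close small] \<eta>0 \<eta>small far
    by (simp add: r_def l)
  have k0: "0 < real k" using k1 L20 LX by linarith
  \<comment> \<open>Since \<open>t\<close> is at most about \<open>k / 4\<close> and
    \<open>m \<le> X\<close>, the binomial coefficient is an \<open>m\<close>-th power of a fixed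
    power of \<open>k\<close>.\<close>
  have "k powr (1 / 200) \<le> (k + m - t) / m"
  proof -
    have "k powr (1 / 200) * (2 * m) \<le> k powr (1 / 200) * (2 * X)"
      using m(1) LX by (intro mult_left_mono) auto
    also have "\<dots> \<le> k" by (rule k3)
    also have "\<dots> \<le> 2 * real (k + m - t)" using t k1 tk L20 LX by (simp add: of_nat_diff)
    finally show ?thesis using m14 by (simp add: field_simps)
  qed
  then have "(k powr (1 / 200)) ^ m \<le> ((k + m - t) / m) ^ m" by (intro power_mono) auto
  also have "\<dots> \<le> real ((k + m - t) choose m)"
    using binomial_ge_n_over_k_pow_k[of m "k + m - t", where 'a = real] tk by simp
  finally have "(k powr (1 / 200)) ^ m \<le> 6 * (real q)\<^sup>2" using main by linarith
  moreover have "(k powr (1 / 200)) ^ m = k powr (m / 400) * k powr (m / 400)"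
    using k0 by (simp add: powr_powr powr_add[symmetric] flip: powr_realpow)
  ultimately have sq: "k powr (m / 400) * k powr (m / 400) \<le> 6 * (real q)\<^sup>2" by simp
  have k1': "1 \<le> real k" using k1 L20 LX by linarith
  \<comment> \<open>One of the two factors \<open>k powr (m / 400)\<close> absorbs the constant 6;
    the square root then leaves the exponent \<open>m / 800\<close>.\<close>
  have "6 \<le> k powr (m / 400)"
    using k4 powr_mono[of "1 / 400" "m / 400" "real k"] k1' m14 by simp
  then have "6 * (real q)\<^sup>2 \<le> k powr (m / 400) * (real q)\<^sup>2" by (intro mult_right_mono) auto
  with sq have "k powr (m / 400) * k powr (m / 400) \<le> k powr (m / 400) * (real q)\<^sup>2" by linarith
  then have "k powr (m / 400) \<le> (real q)\<^sup>2" using k0 by (simp add: mult_le_cancel_left_pos)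
  moreover have "k powr (m / 400) = (k powr (m / 800))\<^sup>2"
    using k0 by (simp add: power2_eq_square powr_add[symmetric])
  ultimately have "(k powr (m / 800))\<^sup>2 \<le> (real q)\<^sup>2" by (simp only:)
  then have "k powr (m / 800) \<le> q" by (rule power2_le_imp_le) simp
  \<comment> \<open>From \<open>L \<ge> 20\<close> follows
    \<open>m \<ge> L - 6 \<ge> L / 2\<close>.\<close>
  moreover have "k powr (- (1 / 1600 * log 2 \<delta>)) \<le> k powr (m / 800)"
    using k1' m L20 by (intro powr_mono) (auto simp: L_def)
  ultimately show ?thesis by linarith
qed

section \<open>Bounded \<open>k\<close>, growth conditions and conclusion\<close>

text \<open>For bounded \<open>k\<close> the assumed gap bounds \<open>- log 2 \<delta>\<close>, so
  a small \<open>c\<close> brings the claimed bound down to 2.\<close>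

lemma small_k_bound:
  fixes k q :: nat and C \<delta> c K :: real
  assumes "2 \<le> q" "1 \<le> real k" "real k \<le> K" "0 < C" "0 < \<delta>" "2 powr (- (C * k powr 0.99)) \<le> \<delta>"
    and c: "0 < c" "c * (C * K * log 2 K) \<le> 1"
  shows "k powr (- (c * log 2 \<delta>)) \<le> q"
proof -
  have "- (C * k powr 0.99) \<le> log 2 \<delta>"
    using assms(5,6) by (simp add: le_log_iff)
  moreover have "k powr 0.99 \<le> K"
    using powr_mono[of "0.99" 1 "real k"] assms(2,3) by simp
  then have "C * k powr 0.99 \<le> C * K" using \<open>0 < C\<close> by simp
  ultimately have "- log 2 \<delta> \<le> C * K" by linarith
  then have "c * (- log 2 \<delta>) \<le> c * (C * K)" using c(1) by (intro mult_left_mono) auto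
  moreover have "log 2 k \<le> log 2 K" "0 \<le> log 2 k" using assms(2,3) by auto
  moreover have "0 \<le> c * (C * K)" using assms by simp
  ultimately have "c * (- log 2 \<delta>) * log 2 k \<le> c * (C * K) * log 2 K"
    by (meson mult_left_mono mult_right_mono order_trans)
  then have "c * (- log 2 \<delta>) * log 2 k \<le> 1" using c(2) by (simp add: mult.assoc)
  then have "2 powr (log 2 k * (c * (- log 2 \<delta>))) \<le> 2 powr 1" by (intro powr_mono) (auto simp: mult_ac)
  moreover have "k powr (- (c * log 2 \<delta>)) = 2 powr (log 2 k * (c * (- log 2 \<delta>)))"
    using powr_powr[of 2 "log 2 k" "c * (- log 2 \<delta>)"] assms(2) by simp
  ultimately show ?thesis using assms(1) by simp
qed

text \<open>The third condition holds because \<open>0.99 + 1 / 200 < 1\<close>.\<close>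

lemma eventually_large_k:
  fixes C :: real
  assumes "0 < C"
  shows "\<forall>\<^sub>F k in at_top. 4 * (C * k powr 0.99) + 4 \<le> (k::real)
    \<and> exp (- (2 powr (k / 2)) / 4) * 2 powr (2 * k) \<le> 1 / 10
    \<and> k powr (1 / 200) * (2 * (C * k powr 0.99)) \<le> k \<and> 6 \<le> k powr (1 / 400)"
proof (intro eventually_conj)
  show "\<forall>\<^sub>F k in at_top. 4 * (C * k powr 0.99) + 4 \<le> (k::real)"
    using assms by real_asymp
  show "\<forall>\<^sub>F k in at_top. exp (- (2 powr (k / 2)) / 4) * 2 powr (2 * k) \<le> 1 / (10::real)"
    by real_asymp
  show "\<forall>\<^sub>F k in at_top. k powr (1 / 200) * (2 * (C * k powr 0.99)) \<le> (k::real)"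
    using assms by real_asymp
  show "\<forall>\<^sub>F k in at_top. 6 \<le> k powr (1 / (400::real))"
    by real_asymp
qed

text \<open>The exponent of the logarithm is absolute, while \<open>c\<close> may depend on the
  constant in the assumed gap. Large \<open>k\<close> are settled by the random instances, bounded
  \<open>k\<close> by the need for two queries.\<close>

theorem theorem3:
  "\<exists>C\<^sub>2 > 0. \<forall>C\<^sub>1 > 0. \<exists>c > 0.
     \<forall>(k::nat) (\<epsilon>\<^sub>1::real) (\<epsilon>\<^sub>2::real) (T::tester) (q::nat).
       0 < \<epsilon>\<^sub>1 \<longrightarrow> \<epsilon>\<^sub>1 < \<epsilon>\<^sub>2 \<longrightarrow> \<epsilon>\<^sub>2 \<le> 0.49 \<longrightarrow>
       \<epsilon>\<^sub>2 - \<epsilon>\<^sub>1 \<ge> 2 powr (- (C\<^sub>1 * real k powr 0.99)) \<longrightarrow>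
       inverse (1 - \<epsilon>\<^sub>1 / \<epsilon>\<^sub>2) \<ge> (log 2 (1 / \<epsilon>\<^sub>2)) powr C\<^sub>2 \<longrightarrow>
       tolerant_junta_tester k \<epsilon>\<^sub>1 \<epsilon>\<^sub>2 T \<longrightarrow>
       makes_at_most_queries T q \<longrightarrow>
       real q \<ge> real k powr (- (c * log 2 (1 - \<epsilon>\<^sub>1 / \<epsilon>\<^sub>2)))"
proof -
  define b where "b = log 2 (1 / 0.49)"
  have "log 2 2 < b" unfolding b_def by (subst log_less_cancel_iff) auto
  then have b: "1 < b" by simp
  then have lb: "0 < log 2 b" by simp
  \<comment> \<open>\<open>b > 1\<close> is the least value of
    \<open>log 2 (1 / \<epsilon>\<^sub>2)\<close>. With this exponent
    \<open>b powr C\<^sub>2 = 2 ^ 20\<close>, and the ratio assumption forces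
    \<open>\<delta> \<le> 1 / 2 ^ 20\<close>.\<close>
  define C\<^sub>2 where "C\<^sub>2 = 20 / log 2 b"
  have C2: "0 < C\<^sub>2" using lb by (simp add: C\<^sub>2_def)
  have "b powr C\<^sub>2 = (2 powr log 2 b) powr C\<^sub>2" using b by simp
  also have "\<dots> = 2 powr 20" using lb unfolding powr_powr by (simp add: C\<^sub>2_def)
  also have "\<dots> = 2 ^ 20" by (simp add: powr_numeral)
  finally have bC2: "b powr C\<^sub>2 = 2 ^ 20" .
  show ?thesis
  proof (rule exI[of _ C\<^sub>2], intro conjI allI impI C2)
    fix C\<^sub>1 :: real assume C1: "0 < C\<^sub>1"
    obtain K where K: "\<And>k::real. K \<le> k \<Longrightarrow> 4 * (C\<^sub>1 * k powr 0.99) + 4 \<le> k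
      \<and> exp (- (2 powr (k / 2)) / 4) * 2 powr (2 * k) \<le> 1 / 10
      \<and> k powr (1 / 200) * (2 * (C\<^sub>1 * k powr 0.99)) \<le> k \<and> 6 \<le> k powr (1 / 400)"
      using eventually_large_k[OF C1] unfolding eventually_at_top_linorder by blast
    define K' where "K' = max K 2"
    have K'_pos: "0 < C\<^sub>1 * K' * log 2 K'" using C1 by (simp add: K'_def)
    \<comment> \<open>The first term serves large \<open>k\<close>, the second \<open>k\<close>
      below the threshold; \<open>K' \<ge> 2\<close> keeps the logarithm positive.\<close>
    define c where "c = min (1 / 1600) (1 / (C\<^sub>1 * K' * log 2 K'))"
    have c: "0 < c" "c \<le> 1 / 1600" "c * (C\<^sub>1 * K' * log 2 K') \<le> 1"
      using K'_pos by (auto simp: c_def min_def field_simps)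
    show "\<exists>c>0. \<forall>(k::nat) (\<epsilon>\<^sub>1::real) (\<epsilon>\<^sub>2::real) (T::tester) (q::nat).
       0 < \<epsilon>\<^sub>1 \<longrightarrow> \<epsilon>\<^sub>1 < \<epsilon>\<^sub>2 \<longrightarrow> \<epsilon>\<^sub>2 \<le> 0.49 \<longrightarrow>
       \<epsilon>\<^sub>2 - \<epsilon>\<^sub>1 \<ge> 2 powr (- (C\<^sub>1 * real k powr 0.99)) \<longrightarrow>
       inverse (1 - \<epsilon>\<^sub>1 / \<epsilon>\<^sub>2) \<ge> (log 2 (1 / \<epsilon>\<^sub>2)) powr C\<^sub>2 \<longrightarrow>
       tolerant_junta_tester k \<epsilon>\<^sub>1 \<epsilon>\<^sub>2 T \<longrightarrow>
       makes_at_most_queries T q \<longrightarrow>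
       real q \<ge> real k powr (- (c * log 2 (1 - \<epsilon>\<^sub>1 / \<epsilon>\<^sub>2)))"
    proof (intro exI[of _ c] conjI allI impI c(1))
      fix k q :: nat and \<epsilon>\<^sub>1 \<epsilon>\<^sub>2 :: real and T :: tester
      assume \<epsilon>: "0 < \<epsilon>\<^sub>1" "\<epsilon>\<^sub>1 < \<epsilon>\<^sub>2" "\<epsilon>\<^sub>2 \<le> 0.49"
        and gap: "2 powr (- (C\<^sub>1 * real k powr 0.99)) \<le> \<epsilon>\<^sub>2 - \<epsilon>\<^sub>1"
        and ratio: "(log 2 (1 / \<epsilon>\<^sub>2)) powr C\<^sub>2 \<le> inverse (1 - \<epsilon>\<^sub>1 / \<epsilon>\<^sub>2)"
        and T: "tolerant_junta_tester k \<epsilon>\<^sub>1 \<epsilon>\<^sub>2 T" and q: "makes_at_most_queries T q"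
      define \<delta> where "\<delta> = 1 - \<epsilon>\<^sub>1 / \<epsilon>\<^sub>2"
      have \<delta>: "0 < \<delta>" "\<delta> < 1" using \<epsilon> by (auto simp: \<delta>_def)
      \<comment> \<open>As \<open>0 powr 0.99 = 0\<close>, the assumed gap would be at least
        1.\<close>
      have "k \<noteq> 0"
      proof
        assume "k = 0"
        then show False using gap \<epsilon> by simp
      qed
      then have k: "1 \<le> real k" by simp
      have "b \<le> log 2 (1 / \<epsilon>\<^sub>2)"
        unfolding b_def using \<epsilon> by (subst log_le_cancel_iff) (auto simp: field_simps)
      then have "2 ^ 20 \<le> (log 2 (1 / \<epsilon>\<^sub>2)) powr C\<^sub>2"
        unfolding bC2[symmetric] using b C2 by (intro powr_mono2) auto
      then have "2 ^ 20 \<le> inverse \<delta>" using ratio by (simp add: \<delta>_def)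
      then have \<delta>20: "\<delta> \<le> 1 / 2 ^ 20" using \<delta> by (simp add: field_simps)
      show "k powr (- (c * log 2 (1 - \<epsilon>\<^sub>1 / \<epsilon>\<^sub>2))) \<le> q"
      proof (cases "K \<le> real k")
        case True
        have "k powr (- (c * log 2 \<delta>)) \<le> k powr (- (1 / 1600 * log 2 \<delta>))"
        proof (rule powr_mono)
          have "log 2 \<delta> \<le> 0" using \<delta> by simp
          then have "c * (- log 2 \<delta>) \<le> 1 / 1600 * (- log 2 \<delta>)" using c(2) by (intro mult_right_mono) auto
          then show "- (c * log 2 \<delta>) \<le> - (1 / 1600 * log 2 \<delta>)" by simp
        qed (rule k)
        also have "\<dots> \<le> q"
          using query_lower_bound_large_k[OF T q \<epsilon> gap \<delta>_def \<delta>20] K[OF True] by blast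
        finally show ?thesis by (simp add: \<delta>_def)
      next
        case False
        have "\<epsilon>\<^sub>2 * \<delta> \<le> 1 * \<delta>" using \<epsilon> \<delta> by (intro mult_right_mono) auto
        moreover have "\<epsilon>\<^sub>2 * \<delta> = \<epsilon>\<^sub>2 - \<epsilon>\<^sub>1" using \<epsilon> by (simp add: \<delta>_def field_simps)
        ultimately have "\<epsilon>\<^sub>2 - \<epsilon>\<^sub>1 \<le> \<delta>" by simp
        then have "2 powr (- (C\<^sub>1 * real k powr 0.99)) \<le> \<delta>" using gap by linarith
        moreover have "2 \<le> q" by (rule tester_ge_two_queries[OF T q]) (use \<epsilon> in auto)
        ultimately show ?thesis
          using small_k_bound[OF _ k _ C1 \<delta>(1) _ c(1,3), of q] False by (simp add: K'_def \<delta>_def)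
      qed
    qed
  qed
qed

end
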